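(* Let $n\ge 1$, let $u>0$ be a smooth solution of the heat equation $\partial_t u=\Delta_x u$ on $\mathbb{R}^n\times(0,\infty)$, and define $f$ by $u(x,t)=t^{-n/2}e^{-f(x,t)}$. Fix $0<\tau_1<\tau_2$ and assume that $f$ and all of its partial derivatives in $x$ and $t$ are bounded on $\mathbb{R}^n\times[\tau_1,\tau_2]$. For $N\ge 3$ set $m=n+N$ and define $v,b,d_0,B$ on $\mathbb{R}^n\times(\mathbb{R}^N\setminus\{0\})$ and $D_0$ as in the context. Then there is a constant $C$ (depending on $n$, $f$, $\tau_1$, $\tau_2$, but not on $N$, $x$, $y$) such that for all $N\ge 3$ and all $(x,y)\in\mathbb{R}^n\times\mathbb{R}^N$ with $\tau:=\frac{|y|^2}{2N}\in[\tau_1,\tau_2]$, \[ \Big|\frac{\Delta(d_0 v)}{v}(x,y)-\frac{m}{b(x,y)^2}|B(x,y)|^2\Big|\le \frac{C}{N},\qquad \big|d_0(x,y)-4D_0(x,\tau)\big|\le\frac{C}{N}, \] \[ \Big|\frac{\Delta(d_0 v)}{v}(x,y)+4\,\frac{\Box(D_0u)}{u}(x,\tau)\Big|\le\frac{C}{N}. \]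
   Context: Points of $\mathbb{R}^m=\mathbb{R}^n\times\mathbb{R}^N$ are written $(x,y)$, $r=|y|$. On $\mathbb{R}^m$, $\nabla$, $\Delta$ and $\mathrm{Hess}$ denote the Euclidean gradient, Laplacian and Hessian in all $m$ variables. Definitions: $v(x,y)=r^{2-m}\exp\big(-f(x,\tfrac{r^2}{2N})\big)$ (equivalently $v=(2N)^{-n/2}|y|^{2-N}u(x,|y|^2/(2N))$); $b=v^{1/(2-m)}$; the elliptic deficit $d_0=2m(|\nabla b|^2-1)$; $B=\mathrm{Hess}(b^2)-\frac{\Delta b^2}{m}I_m$ (the trace-free Hessian of $b^2$), $|B|^2$ its squared Hilbert–Schmidt norm. The parabolic deficit is $D_0(x,t)=t\,(|\nabla_x f|^2+f_t)+\partial_t(t f)$, and $\Box=\partial_t-\Delta_x$ on $\mathbb{R}^n\times(0,\infty)$. *)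

theory Defs
  imports "HOL-Analysis.Analysis"
begin

datatype 'n dir = DX 'n | DT

definition pdx :: "'n::finite \<Rightarrow> ((real^'n) \<times> real \<Rightarrow> real) \<Rightarrow> (real^'n) \<times> real \<Rightarrow> real" where
  "pdx i g p = deriv (\<lambda>s. g (fst p + s *\<^sub>R axis i 1, snd p)) 0"

definition pdt :: "((real^'n::finite) \<times> real \<Rightarrow> real) \<Rightarrow> (real^'n) \<times> real \<Rightarrow> real" where
  "pdt g p = deriv (\<lambda>s. g (fst p, snd p + s)) 0"

fun Dit :: "'n::finite dir list \<Rightarrow> ((real^'n) \<times> real \<Rightarrow> real) \<Rightarrow> (real^'n) \<times> real \<Rightarrow> real" where
  "Dit [] g = g"
| "Dit (DX i # ds) g = pdx i (Dit ds g)"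
| "Dit (DT # ds) g = pdt (Dit ds g)"

definition smooth_half :: "((real^'n::finite) \<times> real \<Rightarrow> real) \<Rightarrow> bool" where
  "smooth_half g \<longleftrightarrow> (\<forall>ds. Dit ds g differentiable_on (UNIV \<times> {0<..}))"

text \<open>Points of R^m = R^n x R^N are pairs (x,y), x :: real^'n, y :: nat => real of which
  only the coordinates j < N are used. Coordinates of R^m are indexed by 'n + nat
  (Inl i for x_i, Inr j for y_j, j < N).\<close>

fun pd :: "('n::finite + nat) \<Rightarrow> ((real^'n) \<times> (nat \<Rightarrow> real) \<Rightarrow> real) \<Rightarrow> (real^'n) \<times> (nat \<Rightarrow> real) \<Rightarrow> real" where
  "pd (Inl i) F p = deriv (\<lambda>s. F (fst p + s *\<^sub>R axis i 1, snd p)) 0"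
| "pd (Inr j) F p = deriv (\<lambda>s. F (fst p, (snd p)(j := snd p j + s))) 0"

definition idx :: "nat \<Rightarrow> ('n::finite + nat) set" where
  "idx N = range Inl \<union> Inr ` {..<N}"

definition lapm :: "nat \<Rightarrow> ((real^'n::finite) \<times> (nat \<Rightarrow> real) \<Rightarrow> real) \<Rightarrow> (real^'n) \<times> (nat \<Rightarrow> real) \<Rightarrow> real" where
  "lapm N F p = (\<Sum>k\<in>idx N. pd k (pd k F) p)"

definition gradsq :: "nat \<Rightarrow> ((real^'n::finite) \<times> (nat \<Rightarrow> real) \<Rightarrow> real) \<Rightarrow> (real^'n) \<times> (nat \<Rightarrow> real) \<Rightarrow> real" where
  "gradsq N F p = (\<Sum>k\<in>idx N. (pd k F p)^2)"

definition normy :: "nat \<Rightarrow> (nat \<Rightarrow> real) \<Rightarrow> real" where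
  "normy N y = sqrt (\<Sum>j<N. (y j)^2)"

definition mdim :: "'n::finite itself \<Rightarrow> nat \<Rightarrow> real" where
  "mdim _ N = real (CARD('n) + N)"

definition vfun :: "((real^'n::finite) \<times> real \<Rightarrow> real) \<Rightarrow> nat \<Rightarrow> (real^'n) \<times> (nat \<Rightarrow> real) \<Rightarrow> real" where
  "vfun f N p = normy N (snd p) powr (2 - mdim TYPE('n) N)
      * exp (- f (fst p, (normy N (snd p))^2 / (2 * real N)))"

definition bfun :: "((real^'n::finite) \<times> real \<Rightarrow> real) \<Rightarrow> nat \<Rightarrow> (real^'n) \<times> (nat \<Rightarrow> real) \<Rightarrow> real" where
  "bfun f N p = vfun f N p powr (1 / (2 - mdim TYPE('n) N))"

definition d0 :: "((real^'n::finite) \<times> real \<Rightarrow> real) \<Rightarrow> nat \<Rightarrow> (real^'n) \<times> (nat \<Rightarrow> real) \<Rightarrow> real" where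
  "d0 f N p = 2 * mdim TYPE('n) N * (gradsq N (bfun f N) p - 1)"

definition Bsq :: "((real^'n::finite) \<times> real \<Rightarrow> real) \<Rightarrow> nat \<Rightarrow> (real^'n) \<times> (nat \<Rightarrow> real) \<Rightarrow> real" where
  "Bsq f N p = (\<Sum>k\<in>idx N. \<Sum>l\<in>idx N.
      (pd k (pd l (\<lambda>q. (bfun f N q)^2)) p
       - (if k = l then lapm N (\<lambda>q. (bfun f N q)^2) p / mdim TYPE('n) N else 0))^2)"

definition D0 :: "((real^'n::finite) \<times> real \<Rightarrow> real) \<Rightarrow> (real^'n) \<times> real \<Rightarrow> real" where
  "D0 f p = snd p * ((\<Sum>i\<in>UNIV. (pdx i f p)^2) + pdt f p) + pdt (\<lambda>q. snd q * f q) p"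

definition heatop :: "((real^'n::finite) \<times> real \<Rightarrow> real) \<Rightarrow> (real^'n) \<times> real \<Rightarrow> real" where
  "heatop g p = pdt g p - (\<Sum>i\<in>UNIV. pdx i (pdx i g) p)"

end

theory Submission
  imports Defs
begin

text \<open>
  All quantities on \<open>\<real>\<^sup>n \<times> \<real>\<^sup>N\<close> depend on \<open>y\<close> only through \<open>t = |y|\<^sup>2/(2N)\<close>, and for
  \<open>F(x,y) = H(x,t)\<close> one has \<open>\<Delta>F = \<Delta>\<^sub>xH + H\<^sub>t + (2t/N) H\<^sub>t\<^sub>t\<close>. With \<open>a = 1/(m-2)\<close>,
  \<open>b\<^sup>2 = 2Nt e\<^bsup>2af\<^esup>\<close> and \<open>d\<^sub>0 = G\<^sub>N(x,t)\<close> where \<open>G\<^sub>N = 4D\<^sub>0 + R\<^sub>N/N\<close> and all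
  derivatives of \<open>R\<^sub>N\<close> are bounded uniformly in \<open>N\<close>. This gives the second estimate. As \<open>v\<close> is
  a constant times \<open>t\<^bsup>(2-N)/2\<^esup>u\<close>, the quotient \<open>\<Delta>(d\<^sub>0v)/v\<close> is the negative of the
  heat operator applied to \<open>G\<^sub>Nu\<close>, divided by \<open>u\<close>, up to \<open>O(1/N)\<close>: the third estimate.
  Expanding \<open>Hess b\<^sup>2\<close> shows that \<open>m|B|\<^sup>2/b\<^sup>2 = 8t|Hess f - I/(2t)|\<^sup>2 + O(1/N)\<close>, and a Bochner
  computation identifies the leading term with \<open>-4\<close> times the heat operator on \<open>D\<^sub>0u\<close> over \<open>u\<close>;
  the first estimate follows.
\<close>


section \<open>Mixed partial derivatives\<close>

text \<open>The factor 2m in d_0 turns an error of size 1/N^2 in |grad b|^2 into one of size 1/N,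
  and the Laplacian then applies second derivatives to the remainder. So e^(2af) has to be expanded
  to second order in a, with remainders that are quotients by powers of a and whose derivatives are
  controlled uniformly in N. This shapes the class \<open>usmooth\<close>: families indexed by N
  with every iterated derivative bounded on the strip. It is closed under algebraic operations and
  under \<open>Dd\<close>, so a uniform bound only requires the error in closed form. Accordingly
  every expansion is an exact identity, a leading term plus a named error divided by N. The exponent
  in b makes the coefficients explicit: m a = 1 + 2a and N a = 1 - (n-2) a. In |B|^2 the y-block has
  N diagonal entries of size 1/N, hence contributes only O(1/N), and the limit sees the x-block
  alone. The Bochner computation needs symmetry of second derivatives, which is derived here from
  differentiability of the iterated partial derivatives, the form in which smoothness is
  given.\<close>

lemma second_difference_eq_mixed_derivative:
  fixes g :: "'a::real_normed_vector \<Rightarrow> real"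
  assumes gv: "\<And>q. q \<in> ball p r \<Longrightarrow> ((\<lambda>s. g (q + s *\<^sub>R v)) has_real_derivative gv q) (at 0)"
    and gvw: "\<And>q. q \<in> ball p r \<Longrightarrow> ((\<lambda>s. gv (q + s *\<^sub>R w)) has_real_derivative gvw q) (at 0)"
    and h: "0 < h" "h * (norm v + norm w) < r"
  shows "\<exists>q\<in>ball p r. g (p + h *\<^sub>R v + h *\<^sub>R w) - g (p + h *\<^sub>R v) - g (p + h *\<^sub>R w) + g p
           = h\<^sup>2 * gvw q"
proof -
  have in_ball: "p + s *\<^sub>R v + t *\<^sub>R w \<in> ball p r" if "0 \<le> s" "s \<le> h" "0 \<le> t" "t \<le> h" for s t
  proof -
    have "norm (s *\<^sub>R v + t *\<^sub>R w) \<le> s * norm v + t * norm w"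
      using that norm_triangle_ineq[of "s *\<^sub>R v" "t *\<^sub>R w"] by simp
    also have "\<dots> \<le> h * norm v + h * norm w"
      by (intro add_mono mult_right_mono) (use that in auto)
    also have "\<dots> < r" using h by (simp add: algebra_simps)
    finally show ?thesis
      by (simp add: dist_norm norm_minus_commute add.assoc add.commute)
  qed
  have gv': "((\<lambda>s. g (p + s *\<^sub>R v + t *\<^sub>R w)) has_real_derivative gv (p + s *\<^sub>R v + t *\<^sub>R w)) (at s)"
    if "0 \<le> s" "s \<le> h" "0 \<le> t" "t \<le> h" for s t
  proof -
    from DERIV_shift[THEN iffD1, of "\<lambda>z. g (p + s *\<^sub>R v + t *\<^sub>R w + z *\<^sub>R v)" _ s "-s"]
    have "((\<lambda>z. g (p + s *\<^sub>R v + t *\<^sub>R w + (z + - s) *\<^sub>R v)) has_real_derivative gv (p + s *\<^sub>R v + t *\<^sub>R w)) (at s)"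
      using gv[OF in_ball[OF that]] by simp
    moreover have "p + s *\<^sub>R v + t *\<^sub>R w + (z + - s) *\<^sub>R v = p + z *\<^sub>R v + t *\<^sub>R w" for z
      by (simp add: algebra_simps)
    ultimately show ?thesis by (simp only:)
  qed
  have gvw': "((\<lambda>t. gv (p + s *\<^sub>R v + t *\<^sub>R w)) has_real_derivative gvw (p + s *\<^sub>R v + t *\<^sub>R w)) (at t)"
    if "0 \<le> s" "s \<le> h" "0 \<le> t" "t \<le> h" for s t
  proof -
    from DERIV_shift[THEN iffD1, of "\<lambda>z. gv (p + s *\<^sub>R v + t *\<^sub>R w + z *\<^sub>R w)" _ t "-t"]
    have "((\<lambda>z. gv (p + s *\<^sub>R v + t *\<^sub>R w + (z + - t) *\<^sub>R w)) has_real_derivative gvw (p + s *\<^sub>R v + t *\<^sub>R w)) (at t)"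
      using gvw[OF in_ball[OF that]] by simp
    moreover have "p + s *\<^sub>R v + t *\<^sub>R w + (z + - t) *\<^sub>R w = p + s *\<^sub>R v + z *\<^sub>R w" for z
      by (simp add: algebra_simps)
    ultimately show ?thesis by (simp only:)
  qed
  \<comment> \<open>The mean value theorem is applied first along v to this difference, then along w
    to \<open>gv\<close>. The summand \<open>0 *\<^sub>R w\<close> gives both terms the shape
    required by \<open>gv'\<close>.\<close>
  let ?F = "\<lambda>s. g (p + s *\<^sub>R v + h *\<^sub>R w) - g (p + s *\<^sub>R v + 0 *\<^sub>R w)"
  have "\<exists>z. 0 < z \<and> z < h \<and> ?F h - ?F 0
          = (h - 0) * (gv (p + z *\<^sub>R v + h *\<^sub>R w) - gv (p + z *\<^sub>R v + 0 *\<^sub>R w))"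
    using h by (intro MVT2 DERIV_diff gv') auto
  then obtain z where z: "0 < z" "z < h" and
    1: "?F h - ?F 0 = h * (gv (p + z *\<^sub>R v + h *\<^sub>R w) - gv (p + z *\<^sub>R v + 0 *\<^sub>R w))" by auto
  have "\<exists>t. 0 < t \<and> t < h \<and> gv (p + z *\<^sub>R v + h *\<^sub>R w) - gv (p + z *\<^sub>R v + 0 *\<^sub>R w)
          = (h - 0) * gvw (p + z *\<^sub>R v + t *\<^sub>R w)"
    using h z by (intro MVT2 gvw') auto
  then obtain t where t: "0 < t" "t < h" and
    2: "gv (p + z *\<^sub>R v + h *\<^sub>R w) - gv (p + z *\<^sub>R v + 0 *\<^sub>R w) = h * gvw (p + z *\<^sub>R v + t *\<^sub>R w)" by auto
  show ?thesis
    using 1 2 in_ball[of z t] z t by (intro bexI[of _ "p + z *\<^sub>R v + t *\<^sub>R w"]) (auto simp: power2_eq_square)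
qed

text \<open>The second difference is symmetric in v and w, so for small h the two mixed derivatives
  take a common value at two points close to p. Continuity carries this over to p.\<close>

lemma mixed_derivatives_commute:
  fixes g :: "'a::real_normed_vector \<Rightarrow> real"
  assumes S: "open S" "p \<in> S"
    and gv: "\<And>q. q \<in> S \<Longrightarrow> ((\<lambda>s. g (q + s *\<^sub>R v)) has_real_derivative gv q) (at 0)"
    and gw: "\<And>q. q \<in> S \<Longrightarrow> ((\<lambda>s. g (q + s *\<^sub>R w)) has_real_derivative gw q) (at 0)"
    and gvw: "\<And>q. q \<in> S \<Longrightarrow> ((\<lambda>s. gv (q + s *\<^sub>R w)) has_real_derivative gvw q) (at 0)"
    and gwv: "\<And>q. q \<in> S \<Longrightarrow> ((\<lambda>s. gw (q + s *\<^sub>R v)) has_real_derivative gwv q) (at 0)"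
    and cont: "isCont gvw p" "isCont gwv p"
  shows "gvw p = gwv p"
proof (rule ccontr)
  assume ne: "gvw p \<noteq> gwv p"
  define e where "e = \<bar>gvw p - gwv p\<bar> / 2"
  have e: "e > 0" using ne by (simp add: e_def)
  obtain r0 where r0: "r0 > 0" "ball p r0 \<subseteq> S" using S openE by blast
  obtain r1 where r1: "r1 > 0" "\<And>q. dist q p < r1 \<Longrightarrow> dist (gvw q) (gvw p) < e"
    using cont(1) e unfolding continuous_at_eps_delta by blast
  obtain r2 where r2: "r2 > 0" "\<And>q. dist q p < r2 \<Longrightarrow> dist (gwv q) (gwv p) < e"
    using cont(2) e unfolding continuous_at_eps_delta by blast
  define r where "r = min r0 (min r1 r2)"
  have r: "r > 0" using r0 r1 r2 by (simp add: r_def)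
  have sub: "q \<in> S" if "q \<in> ball p r" for q using that r0 by (auto simp: r_def)
  \<comment> \<open>The summand 1 keeps the denominator positive when v and w both vanish.\<close>
  define h where "h = r / (2 * (norm v + norm w + 1))"
  have pos: "norm v + norm w + 1 > 0" by (simp add: add_nonneg_pos)
  then have h: "h > 0" using r by (simp add: h_def)
  have "norm v + norm w < 2 * (norm v + norm w + 1)"
    using pos by (simp only: distrib_left)
  from mult_strict_left_mono[OF this h]
  have "h * (norm v + norm w) < h * (2 * (norm v + norm w + 1))" .
  also have "\<dots> = r" unfolding h_def using pos by (auto simp: field_simps)
  finally have hr: "h * (norm v + norm w) < r" .
  have "\<exists>q\<in>ball p r. g (p + h *\<^sub>R v + h *\<^sub>R w) - g (p + h *\<^sub>R v) - g (p + h *\<^sub>R w) + g p = h\<^sup>2 * gvw q"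
    by (rule second_difference_eq_mixed_derivative[of p r g v gv]) (fact gv[OF sub] gvw[OF sub] h hr)+
  then obtain q where q: "q \<in> ball p r"
    "g (p + h *\<^sub>R v + h *\<^sub>R w) - g (p + h *\<^sub>R v) - g (p + h *\<^sub>R w) + g p = h\<^sup>2 * gvw q" ..
  have hr': "h * (norm w + norm v) < r" using hr by (simp add: add.commute)
  have "\<exists>q\<in>ball p r. g (p + h *\<^sub>R w + h *\<^sub>R v) - g (p + h *\<^sub>R w) - g (p + h *\<^sub>R v) + g p = h\<^sup>2 * gwv q"
    by (rule second_difference_eq_mixed_derivative[of p r g w gw]) (fact gw[OF sub] gwv[OF sub] h hr')+
  then obtain q' where q': "q' \<in> ball p r"
    "g (p + h *\<^sub>R w + h *\<^sub>R v) - g (p + h *\<^sub>R w) - g (p + h *\<^sub>R v) + g p = h\<^sup>2 * gwv q'" ..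
  have "h\<^sup>2 * gvw q = h\<^sup>2 * gwv q'"
    using q(2) q'(2) by (simp add: algebra_simps)
  then have "gvw q = gwv q'" using h by simp
  moreover have "dist q p < r1" "dist q' p < r2"
    using q(1) q'(1) by (auto simp: r_def dist_commute)
  then have "dist (gvw q) (gvw p) < e" "dist (gwv q') (gwv p) < e"
    using r1(2) r2(2) by auto
  ultimately show False unfolding e_def dist_real_def by (auto simp: abs_if split: if_splits)
qed

section \<open>Directional derivatives on the half space\<close>

definition half :: "((real^'n::finite) \<times> real) set" where
  "half = UNIV \<times> {0<..}"

fun dvec :: "'n::finite dir \<Rightarrow> (real^'n) \<times> real" where
  "dvec (DX i) = (axis i 1, 0)"
| "dvec DT = (0, 1)"

text \<open>One derivative indexed by direction replaces \<open>pdx\<close> and \<open>pdt\<close>,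
  so each calculus rule is proved once for all coordinates; \<open>Dit\<close> becomes its
  iteration.\<close>

definition Dd :: "'n::finite dir \<Rightarrow> ((real^'n) \<times> real \<Rightarrow> real) \<Rightarrow> (real^'n) \<times> real \<Rightarrow> real" where
  "Dd d g p = deriv (\<lambda>s. g (p + s *\<^sub>R dvec d)) 0"

lemma pdx_eq_Dd: "pdx i g = Dd (DX i) g"
  by (rule ext) (simp add: pdx_def Dd_def plus_prod_def)

lemma pdt_eq_Dd: "pdt g = Dd DT g"
  by (rule ext) (simp add: pdt_def Dd_def plus_prod_def)

lemma Dit_Cons: "Dit (d # ds) g = Dd d (Dit ds g)"
  by (cases d) (auto simp: pdx_eq_Dd pdt_eq_Dd)

lemma open_half: "open half"
  unfolding half_def by (intro open_Times) auto

lemma half_iff: "p \<in> half \<longleftrightarrow> snd p > 0"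
  by (auto simp: half_def mem_Times_iff)

lemma eventually_line_in_half:
  assumes "p \<in> half"
  shows "\<forall>\<^sub>F s in nhds 0. p + s *\<^sub>R v \<in> half"
proof -
  have "((\<lambda>s. p + s *\<^sub>R v) \<longlongrightarrow> p + 0 *\<^sub>R v) (nhds 0)"
    by (intro tendsto_intros) (simp add: filterlim_def)
  then show ?thesis using topological_tendstoD[OF _ open_half] assms by fastforce
qed

text \<open>\<open>deriv\<close> has an unspecified value where no derivative exists. This predicate
  guarantees that \<open>Dd\<close> is a true derivative throughout the half space.\<close>

definition diffable :: "((real^'n::finite) \<times> real \<Rightarrow> real) \<Rightarrow> bool" where
  "diffable g \<longleftrightarrow> (\<forall>p\<in>half. g differentiable (at p))"

lemma diffable_has_derivative_line:
  assumes "diffable g" "p \<in> half"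
  shows "((\<lambda>s. g (p + s *\<^sub>R dvec d)) has_real_derivative Dd d g p) (at 0)"
proof -
  obtain g' where g': "(g has_derivative g') (at p)"
    using assms unfolding diffable_def differentiable_def by blast
  have "((\<lambda>s::real. p + s *\<^sub>R dvec d) has_derivative (\<lambda>s. s *\<^sub>R dvec d)) (at 0)"
    by (auto intro!: derivative_eq_intros)
  from diff_chain_at[OF this, of g g'] g'
  have 1: "((\<lambda>s. g (p + s *\<^sub>R dvec d)) has_derivative (\<lambda>s. g' (s *\<^sub>R dvec d))) (at 0)"
    by (simp add: o_def)
  have "(\<lambda>s. g' (s *\<^sub>R dvec d)) = (*) (g' (dvec d))"
    using linear_scale[OF has_derivative_linear[OF g']] by (auto simp: fun_eq_iff)
  with 1 have "((\<lambda>s. g (p + s *\<^sub>R dvec d)) has_real_derivative g' (dvec d)) (at 0)"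
    unfolding has_field_derivative_def by simp
  then show ?thesis unfolding Dd_def by (metis DERIV_imp_deriv)
qed

lemma Dd_eqI: "((\<lambda>s. g (p + s *\<^sub>R dvec d)) has_real_derivative D) (at 0) \<Longrightarrow> Dd d g p = D"
  unfolding Dd_def by (rule DERIV_imp_deriv)

text \<open>A derivative depends only on the germ, and \<open>half\<close> is open. Formulas valid
  only for t > 0 can thus be substituted under \<open>Dd\<close>, which is how second derivatives
  are reduced to first ones throughout.\<close>

lemma Dd_cong:
  assumes "\<And>q. q \<in> half \<Longrightarrow> g q = h q" "p \<in> half"
  shows "Dd d g p = Dd d h p"
  unfolding Dd_def
  by (rule deriv_cong_ev)
     (rule eventually_mono[OF eventually_line_in_half[OF assms(2), of "dvec d"]], simp_all add: assms(1))

lemma diffable_cong: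
  fixes g h :: "(real^'n::finite) \<times> real \<Rightarrow> real"
  assumes "\<And>q. q \<in> half \<Longrightarrow> g q = h q" "diffable g"
  shows "diffable h"
  unfolding diffable_def
proof
  fix p :: "(real^'n) \<times> real" assume p: "p \<in> half"
  then obtain g' where "(g has_derivative g') (at p)"
    using assms unfolding diffable_def differentiable_def by blast
  then have "(h has_derivative g') (at p)"
    by (rule has_derivative_transform_within_open[OF _ open_half p]) (use assms in auto)
  then show "h differentiable at p" unfolding differentiable_def by blast
qed

lemma Dd_commute:
  assumes "diffable g" "diffable (Dd c g)" "diffable (Dd d g)"
    "diffable (Dd c (Dd d g))" "diffable (Dd d (Dd c g))" "p \<in> half"
  shows "Dd c (Dd d g) p = Dd d (Dd c g) p"
proof (rule mixed_derivatives_commute[OF open_half \<open>p \<in> half\<close>])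
  show "isCont (Dd c (Dd d g)) p" "isCont (Dd d (Dd c g)) p"
    using assms unfolding diffable_def by (auto intro: differentiable_imp_continuous_within)
qed (use assms in \<open>auto intro: diffable_has_derivative_line\<close>)

section \<open>Calculus rules for directional derivatives\<close>

lemma diffable_const [simp]: "diffable (\<lambda>p. c)"
  and diffable_snd [simp]: "diffable snd"
  by (auto simp: diffable_def intro: bounded_linear_imp_differentiable bounded_linear_snd)

lemma diffable_add: "diffable g \<Longrightarrow> diffable h \<Longrightarrow> diffable (\<lambda>p. g p + h p)"
  and diffable_mult: "diffable g \<Longrightarrow> diffable h \<Longrightarrow> diffable (\<lambda>p. g p * h p)"
  by (auto simp: diffable_def intro: differentiable_add differentiable_mult)

lemma diffable_compose:
  fixes g :: "(real^'n::finite) \<times> real \<Rightarrow> real"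
  assumes "diffable g" "\<And>p. p \<in> half \<Longrightarrow> (\<phi> has_real_derivative \<phi>' (g p)) (at (g p))"
  shows "diffable (\<lambda>p. \<phi> (g p))"
  unfolding diffable_def
proof
  fix p :: "(real^'n) \<times> real" assume p: "p \<in> half"
  have "\<phi> differentiable at (g p)"
    using assms(2)[OF p] real_differentiable_def by blast
  then show "(\<lambda>p. \<phi> (g p)) differentiable at p"
    using differentiable_chain_at[of g p \<phi>] assms(1) p by (simp add: diffable_def o_def)
qed

lemma Dd_compose:
  assumes "diffable g" "p \<in> half" "(\<phi> has_real_derivative D) (at (g p))"
  shows "Dd d (\<lambda>p. \<phi> (g p)) p = D * Dd d g p"
  by (rule Dd_eqI, rule DERIV_chain2) (use diffable_has_derivative_line[OF assms(1,2)] assms(3) in auto)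

lemma Dd_const [simp]: "Dd d (\<lambda>p. c) p = 0"
  by (rule Dd_eqI) simp

lemma Dd_snd: "Dd d snd p = (if d = DT then 1 else 0)"
  by (rule Dd_eqI, cases d) (auto intro!: derivative_eq_intros)

lemma Dd_add:
  assumes "diffable g" "diffable h" "p \<in> half"
  shows "Dd d (\<lambda>p. g p + h p) p = Dd d g p + Dd d h p"
  by (rule Dd_eqI) (auto intro!: derivative_eq_intros diffable_has_derivative_line assms)

lemma Dd_mult:
  assumes "diffable g" "diffable h" "p \<in> half"
  shows "Dd d (\<lambda>p. g p * h p) p = g p * Dd d h p + h p * Dd d g p"
  by (rule Dd_eqI)
    (auto intro!: derivative_eq_intros diffable_has_derivative_line assms simp: algebra_simps)

lemma Dd_cmult:
  assumes "diffable g" "p \<in> half"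
  shows "Dd d (\<lambda>p. c * g p) p = c * Dd d g p"
  using Dd_mult[of "\<lambda>_. c" g p d] assms by simp

section \<open>Uniformly bounded families of smooth functions\<close>

definition ubdd :: "'p set \<Rightarrow> (nat \<Rightarrow> 'p \<Rightarrow> real) \<Rightarrow> bool" where
  "ubdd K g \<longleftrightarrow> (\<exists>C. \<forall>N\<ge>3. \<forall>p\<in>K. \<bar>g N p\<bar> \<le> C)"

lemma ubddI: "(\<And>N p. N \<ge> 3 \<Longrightarrow> p \<in> K \<Longrightarrow> \<bar>g N p\<bar> \<le> C) \<Longrightarrow> ubdd K g"
  unfolding ubdd_def by blast

lemma ubddE:
  assumes "ubdd K g"
  obtains C where "C \<ge> 0" "\<And>N p. N \<ge> 3 \<Longrightarrow> p \<in> K \<Longrightarrow> \<bar>g N p\<bar> \<le> C"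
proof -
  obtain C where "\<And>N p. N \<ge> 3 \<Longrightarrow> p \<in> K \<Longrightarrow> \<bar>g N p\<bar> \<le> C"
    using assms unfolding ubdd_def by blast
  then have "\<And>N p. N \<ge> 3 \<Longrightarrow> p \<in> K \<Longrightarrow> \<bar>g N p\<bar> \<le> max 0 C" by (meson max.coboundedI2)
  then show ?thesis using that[of "max 0 C"] by simp
qed

lemma ubdd_cong:
  assumes "ubdd K g" "\<And>N p. N \<ge> 3 \<Longrightarrow> p \<in> K \<Longrightarrow> g N p = h N p"
  shows "ubdd K h"
  using assms unfolding ubdd_def by metis

lemma ubdd_const: "ubdd K (\<lambda>N p. c)"
  by (rule ubddI[of _ _ "\<bar>c\<bar>"]) simp

lemma ubdd_add:
  assumes "ubdd K g" "ubdd K h"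
  shows "ubdd K (\<lambda>N p. g N p + h N p)"
proof -
  obtain C C' where "\<And>N p. N \<ge> 3 \<Longrightarrow> p \<in> K \<Longrightarrow> \<bar>g N p\<bar> \<le> C"
    "\<And>N p. N \<ge> 3 \<Longrightarrow> p \<in> K \<Longrightarrow> \<bar>h N p\<bar> \<le> C'"
    using assms unfolding ubdd_def by blast
  then show ?thesis by (intro ubddI[of _ _ "C + C'"]) (smt (verit))
qed

lemma ubdd_mult:
  assumes "ubdd K g" "ubdd K h"
  shows "ubdd K (\<lambda>N p. g N p * h N p)"
proof -
  obtain C where C: "C \<ge> 0" "\<And>N p. N \<ge> 3 \<Longrightarrow> p \<in> K \<Longrightarrow> \<bar>g N p\<bar> \<le> C"
    using assms ubddE by metis
  obtain C' where C': "C' \<ge> 0" "\<And>N p. N \<ge> 3 \<Longrightarrow> p \<in> K \<Longrightarrow> \<bar>h N p\<bar> \<le> C'"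
    using assms ubddE by metis
  show ?thesis using C C' by (intro ubddI[of _ _ "C * C'"]) (auto simp: abs_mult intro!: mult_mono)
qed

lemma ubdd_uminus: "ubdd K g \<Longrightarrow> ubdd K (\<lambda>N p. - g N p)"
  unfolding ubdd_def by simp

lemma ubdd_diff: "ubdd K g \<Longrightarrow> ubdd K h \<Longrightarrow> ubdd K (\<lambda>N p. g N p - h N p)"
  using ubdd_add[OF _ ubdd_uminus] by fastforce

lemma ubdd_power: "ubdd K g \<Longrightarrow> ubdd K (\<lambda>N p. g N p ^ k)"
  by (induction k) (auto intro: ubdd_const ubdd_mult)

lemma ubdd_sum: "(\<And>i. i \<in> I \<Longrightarrow> ubdd K (g i)) \<Longrightarrow> ubdd K (\<lambda>N p. \<Sum>i\<in>I. g i N p)"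
  by (induction I rule: infinite_finite_induct) (auto intro: ubdd_const ubdd_add)

lemma ubdd_exp:
  assumes "ubdd K g"
  shows "ubdd K (\<lambda>N p. exp (g N p))"
proof -
  obtain C where C: "C \<ge> 0" "\<And>N p. N \<ge> 3 \<Longrightarrow> p \<in> K \<Longrightarrow> \<bar>g N p\<bar> \<le> C"
    using assms ubddE by metis
  then show ?thesis by (intro ubddI[of _ _ "exp C"]) (auto dest: abs_le_D1)
qed

lemmas ubdd_intros = ubdd_const ubdd_add ubdd_mult ubdd_uminus ubdd_diff ubdd_power ubdd_sum ubdd_exp

text \<open>Control of derivatives up to order k. Differentiability is required on all of
  \<open>half\<close> but bounds only on K: the strip of the theorem has boundary points, where
  derivatives need a neighbourhood.\<close>

fun bfam :: "((real^'n::finite) \<times> real) set \<Rightarrow> nat \<Rightarrow> (nat \<Rightarrow> (real^'n) \<times> real \<Rightarrow> real) \<Rightarrow> bool" where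
  "bfam K 0 g \<longleftrightarrow> (\<forall>N\<ge>3. diffable (g N)) \<and> ubdd K g"
| "bfam K (Suc k) g \<longleftrightarrow> bfam K 0 g \<and> (\<forall>d. bfam K k (\<lambda>N. Dd d (g N)))"

definition usmooth :: "((real^'n::finite) \<times> real) set \<Rightarrow> (nat \<Rightarrow> (real^'n) \<times> real \<Rightarrow> real) \<Rightarrow> bool" where
  "usmooth K g \<longleftrightarrow> (\<forall>k. bfam K k g)"

lemma bfam_0I: "bfam K k g \<Longrightarrow> bfam K 0 g"
  by (cases k) auto

lemma bfam_diffable: "bfam K k g \<Longrightarrow> N \<ge> 3 \<Longrightarrow> diffable (g N)"
  and bfam_ubdd: "bfam K k g \<Longrightarrow> ubdd K g"
  using bfam_0I by fastforce+

lemma bfam_SucD: "bfam K (Suc k) g \<Longrightarrow> bfam K k g"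
  by (induction k arbitrary: g) auto

lemma usmooth_Dd: "usmooth K g \<Longrightarrow> usmooth K (\<lambda>N. Dd d (g N))"
  unfolding usmooth_def by (metis bfam.simps(2))

lemma usmooth_diffable: "usmooth K g \<Longrightarrow> N \<ge> 3 \<Longrightarrow> diffable (g N)"
  and usmooth_ubdd: "usmooth K g \<Longrightarrow> ubdd K g"
  unfolding usmooth_def using bfam_diffable bfam_ubdd by blast+

text \<open>A bootstrap: if k controlled orders of g give k controlled orders of each first
  derivative, then k+1 orders of g are controlled. It serves functions whose derivative is expressed
  through themselves, such as exp, the reciprocal and \<open>P\<close> below.\<close>

lemma usmoothI:
  assumes "\<And>N. N \<ge> 3 \<Longrightarrow> diffable (g N)" "ubdd K g"
    "\<And>k d. bfam K k g \<Longrightarrow> bfam K k (\<lambda>N. Dd d (g N))"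
  shows "usmooth K g"
proof -
  have "bfam K k g" for k by (induction k) (use assms in auto)
  then show ?thesis by (simp add: usmooth_def)
qed

lemma bfam_const:
  assumes "\<And>N. N \<ge> 3 \<Longrightarrow> \<bar>c N\<bar> \<le> C"
  shows "bfam K k (\<lambda>N p. c N)"
  using assms
proof (induction k arbitrary: c C)
  case 0
  then show ?case by (auto intro: ubddI)
next
  case (Suc k)
  have D: "(\<lambda>N. Dd d (\<lambda>p. c N)) = (\<lambda>N p. 0)" for d :: "'a dir"
    by (simp add: fun_eq_iff)
  have "bfam K k (\<lambda>N p. 0)" using Suc.IH[of "\<lambda>_. 0" 0] by simp
  then show ?case using Suc.prems by (auto simp: D intro: ubddI)
qed

lemma usmooth_const_seq: "(\<And>N. N \<ge> 3 \<Longrightarrow> \<bar>c N\<bar> \<le> C) \<Longrightarrow> usmooth K (\<lambda>N p. c N)"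
  unfolding usmooth_def using bfam_const by blast

lemma usmooth_const: "usmooth K (\<lambda>N p. c)"
  by (rule usmooth_const_seq[of _ "\<bar>c\<bar>"]) simp

text \<open>The positive lower and finite upper bound on time are what bounds 1/t and ln t; x is
  unrestricted.\<close>

locale half_region =
  fixes K :: "((real^'n::finite) \<times> real) set"
  assumes region: "\<exists>a b. a > 0 \<and> (\<forall>p\<in>K. a \<le> snd p \<and> snd p \<le> b)"
begin

lemma K_half: "p \<in> K \<Longrightarrow> p \<in> half"
  using region by (auto simp: half_iff)

lemma bfam_cong:
  assumes "bfam K k g" "\<And>N p. N \<ge> 3 \<Longrightarrow> p \<in> half \<Longrightarrow> g N p = h N p"
  shows "bfam K k h"
  using assms
proof (induction k arbitrary: g h)
  case 0
  have "diffable (h N)" if "N \<ge> 3" for N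
    by (rule diffable_cong[of "g N"]) (use 0 that in auto)
  moreover have "ubdd K h"
    by (rule ubdd_cong[of _ g]) (use 0 K_half in auto)
  ultimately show ?case by simp
next
  case (Suc k)
  have "bfam K k (\<lambda>N. Dd d (h N))" for d
    by (rule Suc.IH[of "\<lambda>N. Dd d (g N)"]) (use Suc.prems in \<open>auto intro!: Dd_cong\<close>)
  moreover have "diffable (h N)" if "N \<ge> 3" for N
    by (rule diffable_cong[of "g N"]) (use Suc.prems that in auto)
  moreover have "ubdd K h"
    by (rule ubdd_cong[of _ g]) (use Suc.prems K_half in auto)
  ultimately show ?case by simp
qed

lemma usmooth_cong:
  "usmooth K g \<Longrightarrow> (\<And>N p. N \<ge> 3 \<Longrightarrow> p \<in> half \<Longrightarrow> g N p = h N p) \<Longrightarrow> usmooth K h"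
  unfolding usmooth_def using bfam_cong by blast

lemma bfam_add: "bfam K k g \<Longrightarrow> bfam K k h \<Longrightarrow> bfam K k (\<lambda>N p. g N p + h N p)"
proof (induction k arbitrary: g h)
  case 0
  then show ?case by (auto intro: diffable_add ubdd_add)
next
  case (Suc k)
  have "bfam K k (\<lambda>N. Dd d (\<lambda>p. g N p + h N p))" for d
    by (rule bfam_cong[OF Suc.IH[of "\<lambda>N. Dd d (g N)" "\<lambda>N. Dd d (h N)"]])
      (use Suc.prems in \<open>auto simp: Dd_add\<close>)
  then show ?case using Suc.prems by (auto intro: diffable_add ubdd_add)
qed

lemma bfam_mult: "bfam K k g \<Longrightarrow> bfam K k h \<Longrightarrow> bfam K k (\<lambda>N p. g N p * h N p)"
proof (induction k arbitrary: g h)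
  case 0
  then show ?case by (auto intro: diffable_mult ubdd_mult)
next
  case (Suc k)
  have "bfam K k (\<lambda>N. Dd d (\<lambda>p. g N p * h N p))" for d
    by (rule bfam_cong[OF bfam_add[OF Suc.IH[of g "\<lambda>N. Dd d (h N)"] Suc.IH[of h "\<lambda>N. Dd d (g N)"]]])
      (use Suc.prems bfam_SucD in \<open>auto simp: Dd_mult\<close>)
  then show ?case using Suc.prems by (auto intro: diffable_mult ubdd_mult)
qed

lemma usmooth_add: "usmooth K g \<Longrightarrow> usmooth K h \<Longrightarrow> usmooth K (\<lambda>N p. g N p + h N p)"
  and usmooth_mult: "usmooth K g \<Longrightarrow> usmooth K h \<Longrightarrow> usmooth K (\<lambda>N p. g N p * h N p)"
  unfolding usmooth_def using bfam_add bfam_mult by blast+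

lemma usmooth_uminus: "usmooth K g \<Longrightarrow> usmooth K (\<lambda>N p. - g N p)"
  using usmooth_mult[OF usmooth_const[of _ "-1"], of g] by simp

lemma usmooth_diff: "usmooth K g \<Longrightarrow> usmooth K h \<Longrightarrow> usmooth K (\<lambda>N p. g N p - h N p)"
  using usmooth_add[OF _ usmooth_uminus, of g h] by simp

lemma usmooth_power: "usmooth K g \<Longrightarrow> usmooth K (\<lambda>N p. g N p ^ k)"
  by (induction k) (auto intro: usmooth_const usmooth_mult)

lemma usmooth_sum: "(\<And>i. i \<in> I \<Longrightarrow> usmooth K (g i)) \<Longrightarrow> usmooth K (\<lambda>N p. \<Sum>i\<in>I. g i N p)"
  by (induction I rule: infinite_finite_induct) (auto intro: usmooth_const usmooth_add)

lemma usmooth_snd: "usmooth K (\<lambda>N p. snd p)"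
proof (rule usmoothI)
  obtain a b where "a > 0" "\<forall>p\<in>K. a \<le> snd p \<and> snd p \<le> b" using region by blast
  then show "ubdd K (\<lambda>N p. snd p)" by (intro ubddI[of _ _ b]) (auto simp: abs_if)
  fix k and d :: "'n dir"
  show "bfam K k (\<lambda>N. Dd d snd)"
    by (rule bfam_cong[of _ "\<lambda>N p. if d = DT then 1 else 0"])
      (use bfam_const[of "\<lambda>_. if d = DT then 1 else 0" 1] in \<open>auto simp: Dd_snd\<close>)
qed auto

lemma usmooth_exp:
  assumes "usmooth K g"
  shows "usmooth K (\<lambda>N p. exp (g N p))"
proof (rule usmoothI)
  show "diffable (\<lambda>p. exp (g N p))" if "N \<ge> 3" for N
    by (rule diffable_compose[of _ _ exp]) (use assms that usmooth_diffable in auto)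
  show "ubdd K (\<lambda>N p. exp (g N p))" using assms by (intro ubdd_exp usmooth_ubdd)
  fix k d assume *: "bfam K k (\<lambda>N p. exp (g N p))"
  have "bfam K k (\<lambda>N. Dd d (g N))" using usmooth_Dd[OF assms, of d] by (simp add: usmooth_def)
  from bfam_mult[OF * this] show "bfam K k (\<lambda>N. Dd d (\<lambda>p. exp (g N p)))"
    by (rule bfam_cong) (use assms usmooth_diffable in \<open>auto intro!: Dd_compose[symmetric] derivative_eq_intros\<close>)
qed

text \<open>The derivative of 1/g is -(1/g)^2 Dg, so the bootstrap applies and the only new bound
  required is one on 1/g itself.\<close>

lemma usmooth_inverse:
  assumes g: "usmooth K g" and pos: "\<And>N p. N \<ge> 3 \<Longrightarrow> p \<in> half \<Longrightarrow> g N p > 0"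
    and bdd: "ubdd K (\<lambda>N p. inverse (g N p))"
  shows "usmooth K (\<lambda>N p. inverse (g N p))"
proof (rule usmoothI)
  have inv: "(inverse has_real_derivative - (inverse (g N p) * inverse (g N p))) (at (g N p))"
    if "N \<ge> 3" "p \<in> half" for N p
    using pos[OF that] by (auto intro!: derivative_eq_intros simp: power2_eq_square)
  show "diffable (\<lambda>p. inverse (g N p))" if "N \<ge> 3" for N
    by (rule diffable_compose[of _ _ "\<lambda>z. - (inverse z * inverse z)"])
      (use g inv that usmooth_diffable in auto)
  fix k d assume *: "bfam K k (\<lambda>N p. inverse (g N p))"
  have "bfam K k (\<lambda>N p. - Dd d (g N) p)"
    using usmooth_uminus[OF usmooth_Dd[OF g, of d]] by (simp add: usmooth_def)
  from bfam_mult[OF bfam_mult[OF * *] this] show "bfam K k (\<lambda>N. Dd d (\<lambda>p. inverse (g N p)))"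
    by (rule bfam_cong)
      (use Dd_compose[OF usmooth_diffable[OF g] _ inv] in \<open>auto\<close>)
qed (rule bdd)

lemma usmooth_ln:
  assumes g: "usmooth K g" and pos: "\<And>N p. N \<ge> 3 \<Longrightarrow> p \<in> half \<Longrightarrow> g N p > 0"
    and bdd: "ubdd K (\<lambda>N p. inverse (g N p))" "ubdd K (\<lambda>N p. ln (g N p))"
  shows "usmooth K (\<lambda>N p. ln (g N p))"
proof (rule usmoothI)
  have ln: "(ln has_real_derivative inverse (g N p)) (at (g N p))"
    if "N \<ge> 3" "p \<in> half" for N p
    using pos[OF that] by (auto intro!: derivative_eq_intros simp: divide_inverse)
  show "diffable (\<lambda>p. ln (g N p))" if "N \<ge> 3" for N
    by (rule diffable_compose[of _ _ inverse])
      (use g ln that usmooth_diffable in auto)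
  fix k d
  have "usmooth K (\<lambda>N p. inverse (g N p) * Dd d (g N) p)"
    by (intro usmooth_mult usmooth_inverse usmooth_Dd g pos bdd)
  then have "bfam K k (\<lambda>N p. inverse (g N p) * Dd d (g N) p)"
    by (simp add: usmooth_def)
  then show "bfam K k (\<lambda>N. Dd d (\<lambda>p. ln (g N p)))"
    by (rule bfam_cong)
      (use Dd_compose[OF usmooth_diffable[OF g] _ ln] in \<open>auto\<close>)
qed (rule bdd)

lemma ubdd_inverse_snd: "ubdd K (\<lambda>N p. inverse (snd p))"
proof -
  obtain a b where "a > 0" "\<forall>p\<in>K. a \<le> snd p \<and> snd p \<le> b" using region by blast
  then show ?thesis by (intro ubddI[of _ _ "inverse a"]) (auto intro!: le_imp_inverse_le)
qed

lemma usmooth_ln_snd: "usmooth K (\<lambda>N p. ln (snd p))"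
proof (rule usmooth_ln[OF usmooth_snd _ ubdd_inverse_snd])
  obtain a b where ab: "a > 0" "\<forall>p\<in>K. a \<le> snd p \<and> snd p \<le> b" using region by blast
  have "\<bar>ln (snd p)\<bar> \<le> \<bar>ln a\<bar> + \<bar>ln b\<bar>" if "p \<in> K" for p
  proof -
    have "ln a \<le> ln (snd p)" "ln (snd p) \<le> ln b"
      using ab that by (auto intro!: ln_mono)
    then show ?thesis by linarith
  qed
  then show "ubdd K (\<lambda>N p. ln (snd p))" by (intro ubddI) auto
qed (auto simp: half_iff)

end

lemmas (in half_region) usmooth_intros =
  usmooth_const usmooth_add usmooth_mult usmooth_uminus usmooth_diff usmooth_power usmooth_sum
  usmooth_snd usmooth_exp usmooth_Dd usmooth_ln_snd

section \<open>Functions of \<open>x\<close> and \<open>|y|\<^sup>2 / 2N\<close>\<close>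

definition tau :: "nat \<Rightarrow> (nat \<Rightarrow> real) \<Rightarrow> real" where
  "tau N y = (normy N y)\<^sup>2 / (2 * real N)"

definition proj :: "nat \<Rightarrow> (real^'n) \<times> (nat \<Rightarrow> real) \<Rightarrow> (real^'n) \<times> real" where
  "proj N p = (fst p, tau N (snd p))"

lemma normy_sq: "(normy N y)\<^sup>2 = (\<Sum>j<N. (y j)\<^sup>2)"
  unfolding normy_def by (simp add: sum_nonneg)

lemma sum_sq_eq_tau: "N > 0 \<Longrightarrow> (\<Sum>j<N. (y j)\<^sup>2) = 2 * real N * tau N y"
  by (simp add: tau_def normy_sq)

lemma tau_upd:
  assumes "j < N"
  shows "tau N (y(j := y j + s)) = tau N y + (2 * y j * s + s\<^sup>2) / (2 * real N)"
proof -
  have "(\<Sum>k<N. ((y(j := y j + s)) k)\<^sup>2) = (\<Sum>k<N. (y k)\<^sup>2 + (if k = j then 2 * y j * s + s\<^sup>2 else 0))"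
    by (intro sum.cong) (auto simp: power2_eq_square algebra_simps)
  also have "\<dots> = (\<Sum>k<N. (y k)\<^sup>2) + (2 * y j * s + s\<^sup>2)"
    using assms by (simp add: sum.distrib)
  finally show ?thesis by (simp add: tau_def normy_sq add_divide_distrib)
qed

lemma tau_upd_tendsto:
  assumes "j < N"
  shows "((\<lambda>s. tau N (y(j := y j + s))) \<longlongrightarrow> tau N y) (nhds 0)"
proof -
  have "((\<lambda>s. tau N y + (2 * y j * s + s\<^sup>2) / (2 * real N)) \<longlongrightarrow> tau N y + (2 * y j * 0 + 0\<^sup>2) / (2 * real N)) (nhds 0)"
    using assms by (intro tendsto_intros) (auto simp: filterlim_def)
  then show ?thesis using tau_upd[OF assms] by simp
qed

text \<open>Serves formulas that hold only off y = 0. Moving an x-coordinate leaves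
  \<open>tau\<close> unchanged, and a small move of a y-coordinate keeps it positive.\<close>

lemma pd_cong:
  assumes "\<And>p. tau N (snd p) > 0 \<Longrightarrow> F p = G p" "tau N (snd p) > 0" "k \<in> idx N"
  shows "pd k F p = pd k G p"
proof (cases k)
  case (Inl i)
  then show ?thesis using assms(1,2) by simp
next
  case (Inr j)
  with assms have j: "j < N" by (auto simp: idx_def)
  have "\<forall>\<^sub>F s in nhds 0. tau N ((snd p)(j := snd p j + s)) > 0"
    using order_tendstoD(1)[OF tau_upd_tendsto[OF j] assms(2)] .
  then have "\<forall>\<^sub>F s in nhds 0. F (fst p, (snd p)(j := snd p j + s)) = G (fst p, (snd p)(j := snd p j + s))"
    by eventually_elim (simp add: assms(1))
  then show ?thesis using Inr by (auto intro: deriv_cong_ev)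
qed

lemma sum_idx: "(\<Sum>k\<in>idx N. g k) = (\<Sum>i\<in>UNIV. g (Inl i)) + (\<Sum>j<N. g (Inr j))"
proof -
  have "(\<Sum>k\<in>idx N. g k) = sum g (range Inl) + sum g (Inr ` {..<N})"
    unfolding idx_def by (rule sum.union_disjoint) auto
  then show ?thesis by (simp add: sum.reindex)
qed

lemma Inl_idx [simp]: "Inl i \<in> idx N" and Inr_idx [simp]: "Inr j \<in> idx N \<longleftrightarrow> j < N"
  by (auto simp: idx_def)

lemma lapm_cong:
  assumes "\<And>p. tau N (snd p) > 0 \<Longrightarrow> F p = G p" "tau N (snd p) > 0"
  shows "lapm N F p = lapm N G p"
  unfolding lapm_def using assms by (intro sum.cong refl pd_cong[of N]) (auto intro: pd_cong[of N])

lemma gradsq_cong: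
  assumes "\<And>p. tau N (snd p) > 0 \<Longrightarrow> F p = G p" "tau N (snd p) > 0"
  shows "gradsq N F p = gradsq N G p"
  unfolding gradsq_def using assms by (intro sum.cong refl arg_cong[where f = "\<lambda>z. z\<^sup>2"] pd_cong[of N])

lemma proj_half: "tau N (snd p) > 0 \<Longrightarrow> proj N p \<in> half"
  by (simp add: proj_def half_iff)

lemma pd_Inl_proj: "pd (Inl i) (\<lambda>p. H (proj N p)) p = Dd (DX i) H (proj N p)"
  by (simp add: Dd_def proj_def)

text \<open>Moving y_j by s moves only t, by the exact amount (2 y_j s + s^2)/(2N), so the chain
  rule yields the factor y_j/N.\<close>

lemma Inr_line_has_derivative:
  assumes "diffable H" "tau N (snd p) > 0" "j < N"
  shows "((\<lambda>s. H (proj N (fst p, (snd p)(j := snd p j + s)))) has_real_derivative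
           snd p j / real N * Dd DT H (proj N p)) (at 0)"
proof -
  let ?r = "\<lambda>s. (2 * snd p j * s + s\<^sup>2) / (2 * real N)"
  have 1: "(?r has_real_derivative snd p j / real N) (at 0)"
    using assms by (auto intro!: derivative_eq_intros)
  have 2: "((\<lambda>s. H (proj N p + s *\<^sub>R dvec DT)) has_real_derivative Dd DT H (proj N p)) (at (?r 0))"
    using diffable_has_derivative_line[OF assms(1) proj_half[OF assms(2)], of DT] by simp
  have "((\<lambda>s. H (proj N p + ?r s *\<^sub>R dvec DT)) has_real_derivative Dd DT H (proj N p) * (snd p j / real N)) (at 0)"
    using DERIV_chain2[OF 2 1] .
  moreover have "proj N p + ?r s *\<^sub>R dvec DT = proj N (fst p, (snd p)(j := snd p j + s))" for s
    using assms by (simp add: proj_def tau_upd)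
  ultimately show ?thesis by (simp add: mult.commute)
qed

lemma pd_Inr_proj:
  assumes "diffable H" "tau N (snd p) > 0" "j < N"
  shows "pd (Inr j) (\<lambda>p. H (proj N p)) p = snd p j / real N * Dd DT H (proj N p)"
  using DERIV_imp_deriv[OF Inr_line_has_derivative[OF assms]] by simp

text \<open>A first y_j-derivative is (y_j/N) H_t, no longer a function of (x,t) alone. This lemma
  and the next differentiate such products once more; the diagonal case gives the extra
  H_t/N.\<close>

lemma pd_Inl_coord_proj:
  assumes "diffable H" "tau N (snd p) > 0"
  shows "pd (Inl i) (\<lambda>p. snd p j / real N * H (proj N p)) p
           = snd p j / real N * Dd (DX i) H (proj N p)"
proof -
  have "((\<lambda>s. snd p j / real N * H (proj N p + s *\<^sub>R dvec (DX i))) has_real_derivative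
          snd p j / real N * Dd (DX i) H (proj N p)) (at 0)"
    by (intro DERIV_cmult diffable_has_derivative_line assms proj_half)
  from DERIV_imp_deriv[OF this] show ?thesis by (simp add: proj_def)
qed

lemma pd_Inr_coord_proj:
  assumes "diffable H" "tau N (snd p) > 0" "k < N"
  shows "pd (Inr k) (\<lambda>p. snd p j / real N * H (proj N p)) p
           = (if k = j then 1 / real N else 0) * H (proj N p)
             + snd p j / real N * (snd p k / real N * Dd DT H (proj N p))"
proof -
  let ?y = "\<lambda>s. ((snd p)(k := snd p k + s)) j / real N"
  have "(?y has_real_derivative (if k = j then 1 / real N else 0)) (at 0)"
    using assms by (auto intro!: derivative_eq_intros)
  from DERIV_mult[OF this Inr_line_has_derivative[OF assms]]
  have "((\<lambda>s. ?y s * H (proj N (fst p, (snd p)(k := snd p k + s)))) has_real_derivative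
        (if k = j then 1 / real N else 0) * H (proj N p)
             + snd p j / real N * (snd p k / real N * Dd DT H (proj N p))) (at 0)"
    by (rule DERIV_cong) (auto simp: algebra_simps)
  from DERIV_imp_deriv[OF this] show ?thesis by simp
qed

section \<open>Gradient, Laplacian and Hessian of functions of (x,t) lifted to (x,y)\<close>

context
  fixes H :: "(real^'n::finite) \<times> real \<Rightarrow> real" and N :: nat and p :: "(real^'n) \<times> (nat \<Rightarrow> real)"
  assumes H: "diffable H" "\<And>d. diffable (Dd d H)" and p: "tau N (snd p) > 0"
begin

lemma pd2_proj:
  shows "pd (Inl i) (pd (Inl j) (\<lambda>p. H (proj N p))) p = Dd (DX i) (Dd (DX j) H) (proj N p)"
    and "k < N \<Longrightarrow> pd (Inl i) (pd (Inr k) (\<lambda>p. H (proj N p))) p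
           = snd p k / real N * Dd (DX i) (Dd DT H) (proj N p)"
    and "k < N \<Longrightarrow> pd (Inr k) (pd (Inl j) (\<lambda>p. H (proj N p))) p
           = snd p k / real N * Dd DT (Dd (DX j) H) (proj N p)"
    and "k < N \<Longrightarrow> l < N \<Longrightarrow> pd (Inr k) (pd (Inr l) (\<lambda>p. H (proj N p))) p
           = (if k = l then 1 / real N else 0) * Dd DT H (proj N p)
             + snd p l / real N * (snd p k / real N * Dd DT (Dd DT H) (proj N p))"
proof -
  have x: "pd (Inl j) (\<lambda>p. H (proj N p)) = (\<lambda>p. Dd (DX j) H (proj N p))" for j
    by (rule ext) (rule pd_Inl_proj)
  show "pd (Inl i) (pd (Inl j) (\<lambda>p. H (proj N p))) p = Dd (DX i) (Dd (DX j) H) (proj N p)"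
    unfolding x by (rule pd_Inl_proj)
  show "pd (Inr k) (pd (Inl j) (\<lambda>p. H (proj N p))) p
           = snd p k / real N * Dd DT (Dd (DX j) H) (proj N p)" if "k < N"
    unfolding x using H p that by (rule_tac pd_Inr_proj)
  \<comment> \<open>The formula for the inner y-derivative holds only where \<open>tau\<close> is
    positive, so it enters by congruence, unlike the global identity \<open>x\<close>.\<close>
  have y: "pd m (pd (Inr l) (\<lambda>p. H (proj N p))) p = pd m (\<lambda>p. snd p l / real N * Dd DT H (proj N p)) p"
    if "l < N" "m \<in> idx N" for l m
    by (rule pd_cong[of N]) (use that H p pd_Inr_proj in auto)
  show "pd (Inl i) (pd (Inr k) (\<lambda>p. H (proj N p))) p
           = snd p k / real N * Dd (DX i) (Dd DT H) (proj N p)" if "k < N"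
    unfolding y[OF that Inl_idx] by (intro pd_Inl_coord_proj H p)
  show "pd (Inr k) (pd (Inr l) (\<lambda>p. H (proj N p))) p
           = (if k = l then 1 / real N else 0) * Dd DT H (proj N p)
             + snd p l / real N * (snd p k / real N * Dd DT (Dd DT H) (proj N p))" if "k < N" "l < N"
    unfolding y[OF that(2) Inr_idx[THEN iffD2, OF that(1)]] by (intro pd_Inr_coord_proj H p that)
qed

lemma N_pos: "N > 0"
  using p by (cases N) (auto simp: tau_def)

lemma gradsq_proj:
  "gradsq N (\<lambda>p. H (proj N p)) p
     = (\<Sum>i\<in>UNIV. (Dd (DX i) H (proj N p))\<^sup>2) + 2 * snd (proj N p) / real N * (Dd DT H (proj N p))\<^sup>2"
proof -
  have "(\<Sum>j<N. (pd (Inr j) (\<lambda>p. H (proj N p)) p)\<^sup>2)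
          = (\<Sum>j<N. (snd p j)\<^sup>2) * (Dd DT H (proj N p) / real N)\<^sup>2"
    unfolding sum_distrib_right
    by (intro sum.cong refl) (simp del: pd.simps add: pd_Inr_proj H p power_mult_distrib power_divide)
  also have "\<dots> = 2 * snd (proj N p) / real N * (Dd DT H (proj N p))\<^sup>2"
    using N_pos by (simp add: sum_sq_eq_tau proj_def power_divide) (simp add: power2_eq_square)
  finally show ?thesis unfolding gradsq_def sum_idx by (simp del: pd.simps add: pd_Inl_proj)
qed

text \<open>The N diagonal terms H_t/N add up to a full H_t: this is how the extra dimensions
  produce a time derivative. The last term comes from the sum of y_j^2/N^2, which is 2t/N.\<close>

lemma lapm_proj:
  "lapm N (\<lambda>p. H (proj N p)) p
     = (\<Sum>i\<in>UNIV. Dd (DX i) (Dd (DX i) H) (proj N p)) + Dd DT H (proj N p)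
       + 2 * snd (proj N p) / real N * Dd DT (Dd DT H) (proj N p)"
proof -
  have "(\<Sum>j<N. pd (Inr j) (pd (Inr j) (\<lambda>p. H (proj N p))) p)
          = (\<Sum>j<N. Dd DT H (proj N p) / real N + (snd p j)\<^sup>2 * (Dd DT (Dd DT H) (proj N p) / (real N)\<^sup>2))"
    by (intro sum.cong refl) (simp del: pd.simps add: pd2_proj power2_eq_square)
  also have "\<dots> = Dd DT H (proj N p) + (\<Sum>j<N. (snd p j)\<^sup>2) * (Dd DT (Dd DT H) (proj N p) / (real N)\<^sup>2)"
    using N_pos by (simp only: sum.distrib sum_distrib_right) simp
  also have "\<dots> = Dd DT H (proj N p) + 2 * snd (proj N p) / real N * Dd DT (Dd DT H) (proj N p)"
    unfolding sum_sq_eq_tau[OF N_pos] using N_pos by (simp add: proj_def power2_eq_square)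
  finally show ?thesis unfolding lapm_def sum_idx by (simp del: pd.simps add: pd2_proj)
qed

text \<open>The yy-block is \<mu> I + h y y^T with \<mu> = H_t/N - c and h = H_tt/N^2, so its
  squared norm is N \<mu>^2 + 2 \<mu> h |y|^2 + h^2 |y|^4. The two mixed blocks enter separately, so
  that no symmetry has to be invoked.\<close>

lemma sum_sq_shifted_hessian_proj:
  "(\<Sum>k\<in>idx N. \<Sum>l\<in>idx N. (pd k (pd l (\<lambda>p. H (proj N p))) p - (if k = l then c else 0))\<^sup>2)
   = (\<Sum>i\<in>UNIV. \<Sum>j\<in>UNIV. (Dd (DX i) (Dd (DX j) H) (proj N p) - (if i = j then c else 0))\<^sup>2)
     + 2 * snd (proj N p) / real N * ((\<Sum>i\<in>UNIV. (Dd (DX i) (Dd DT H) (proj N p))\<^sup>2)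
                                  + (\<Sum>i\<in>UNIV. (Dd DT (Dd (DX i) H) (proj N p))\<^sup>2))
     + (real N * (Dd DT H (proj N p) / real N - c)\<^sup>2
        + 2 * (Dd DT H (proj N p) / real N - c) * (2 * snd (proj N p) / real N * Dd DT (Dd DT H) (proj N p))
        + (2 * snd (proj N p) / real N * Dd DT (Dd DT H) (proj N p))\<^sup>2)"
proof -
  let ?t = "snd (proj N p)" and ?D = "\<lambda>k l. pd k (pd l (\<lambda>p. H (proj N p))) p - (if k = l then c else 0)"
  let ?T = "Dd DT H (proj N p)" and ?TT = "Dd DT (Dd DT H) (proj N p)"
  have S: "(\<Sum>j<N. (snd p j)\<^sup>2) = 2 * real N * ?t"
    using N_pos by (simp add: sum_sq_eq_tau proj_def)
  have xy: "(\<Sum>k<N. (?D (Inl i) (Inr k))\<^sup>2) = 2 * ?t / real N * (Dd (DX i) (Dd DT H) (proj N p))\<^sup>2" for i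
  proof -
    have "(\<Sum>k<N. (?D (Inl i) (Inr k))\<^sup>2) = (\<Sum>k<N. (snd p k)\<^sup>2) * (Dd (DX i) (Dd DT H) (proj N p) / real N)\<^sup>2"
      unfolding sum_distrib_right
      by (intro sum.cong refl) (simp del: pd.simps add: pd2_proj power_mult_distrib power_divide)
    then show ?thesis unfolding S using N_pos by (simp add: power_divide power2_eq_square)
  qed
  have yx: "(\<Sum>k<N. (?D (Inr k) (Inl i))\<^sup>2) = 2 * ?t / real N * (Dd DT (Dd (DX i) H) (proj N p))\<^sup>2" for i
  proof -
    have "(\<Sum>k<N. (?D (Inr k) (Inl i))\<^sup>2) = (\<Sum>k<N. (snd p k)\<^sup>2) * (Dd DT (Dd (DX i) H) (proj N p) / real N)\<^sup>2"
      unfolding sum_distrib_right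
      by (intro sum.cong refl) (simp del: pd.simps add: pd2_proj power_mult_distrib power_divide)
    then show ?thesis unfolding S using N_pos by (simp add: power_divide power2_eq_square)
  qed
  define \<mu> where "\<mu> = ?T / real N - c"
  define h where "h = ?TT / (real N)\<^sup>2"
  have "(\<Sum>k<N. \<Sum>l<N. (?D (Inr k) (Inr l))\<^sup>2)
      = (\<Sum>k<N. \<Sum>l<N. (if k = l then \<mu>\<^sup>2 + 2 * \<mu> * h * (snd p k)\<^sup>2 else 0) + h\<^sup>2 * (snd p k)\<^sup>2 * (snd p l)\<^sup>2)"
  proof (intro sum.cong refl)
    fix k l assume kl: "k \<in> {..<N}" "l \<in> {..<N}"
    have D: "?D (Inr k) (Inr l) = (if k = l then \<mu> else 0) + h * snd p k * snd p l"
      using kl by (simp del: pd.simps add: pd2_proj \<mu>_def h_def power2_eq_square)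
    show "(?D (Inr k) (Inr l))\<^sup>2 =
        (if k = l then \<mu>\<^sup>2 + 2 * \<mu> * h * (snd p k)\<^sup>2 else 0) + h\<^sup>2 * (snd p k)\<^sup>2 * (snd p l)\<^sup>2"
      unfolding D by (cases "k = l") (simp_all add: power2_eq_square algebra_simps)
  qed
  also have "\<dots> = (\<Sum>k<N. \<mu>\<^sup>2 + 2 * \<mu> * h * (snd p k)\<^sup>2) + (\<Sum>k<N. \<Sum>l<N. h\<^sup>2 * (snd p k)\<^sup>2 * (snd p l)\<^sup>2)"
    by (simp add: sum.distrib)
  also have "(\<Sum>k<N. \<Sum>l<N. h\<^sup>2 * (snd p k)\<^sup>2 * (snd p l)\<^sup>2)
      = h\<^sup>2 * ((\<Sum>k<N. (snd p k)\<^sup>2) * (\<Sum>k<N. (snd p k)\<^sup>2))"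
    by (simp only: sum_product) (simp only: sum_distrib_left mult.assoc)
  also have "\<dots> = (h * (\<Sum>k<N. (snd p k)\<^sup>2))\<^sup>2"
    by (simp only: power2_eq_square mult_ac)
  also have "(\<Sum>k<N. \<mu>\<^sup>2 + 2 * \<mu> * h * (snd p k)\<^sup>2)
      = real N * \<mu>\<^sup>2 + 2 * \<mu> * (h * (\<Sum>k<N. (snd p k)\<^sup>2))"
    unfolding sum.distrib sum_distrib_left by (simp add: mult.assoc)
  also have "h * (\<Sum>k<N. (snd p k)\<^sup>2) = 2 * ?t / real N * ?TT"
    unfolding S h_def using N_pos by (simp add: power2_eq_square)
  finally have yy: "(\<Sum>k<N. \<Sum>l<N. (?D (Inr k) (Inr l))\<^sup>2) =
    real N * \<mu>\<^sup>2 + 2 * \<mu> * (2 * ?t / real N * ?TT) + (2 * ?t / real N * ?TT)\<^sup>2" .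
  have "(\<Sum>k\<in>idx N. \<Sum>l\<in>idx N. (?D k l)\<^sup>2) =
     (\<Sum>i\<in>UNIV. \<Sum>j\<in>UNIV. (?D (Inl i) (Inl j))\<^sup>2) + (\<Sum>i\<in>UNIV. \<Sum>k<N. (?D (Inl i) (Inr k))\<^sup>2)
     + (\<Sum>i\<in>UNIV. \<Sum>k<N. (?D (Inr k) (Inl i))\<^sup>2) + (\<Sum>k<N. \<Sum>l<N. (?D (Inr k) (Inr l))\<^sup>2)"
    unfolding sum_idx sum.distrib sum.swap[of "\<lambda>k i. (?D (Inr k) (Inl i))\<^sup>2" UNIV "{..<N}"]
    by (simp only: add.assoc)
  also have "(\<Sum>i\<in>UNIV. \<Sum>j\<in>UNIV. (?D (Inl i) (Inl j))\<^sup>2)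
      = (\<Sum>i\<in>UNIV. \<Sum>j\<in>UNIV. (Dd (DX i) (Dd (DX j) H) (proj N p) - (if i = j then c else 0))\<^sup>2)"
    by (simp del: pd.simps add: pd2_proj)
  finally show ?thesis
    unfolding xy yx yy \<mu>_def[symmetric] sum_distrib_left distrib_left by (simp only: add.assoc)
qed

end

section \<open>The conjugated heat operator\<close>

text \<open>Over the empty region the bounds are void, so only smoothness remains.\<close>

definition smooth :: "((real^'n::finite) \<times> real \<Rightarrow> real) \<Rightarrow> bool" where
  "smooth g \<longleftrightarrow> usmooth {} (\<lambda>N. g)"

interpretation empty: half_region "{} :: ((real^'n::finite) \<times> real) set"
  by unfold_locales (auto intro: exI[of _ 1])

lemma smooth_diffable: "smooth g \<Longrightarrow> diffable g"
  unfolding smooth_def using usmooth_diffable by blast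

lemma smooth_Dd: "smooth g \<Longrightarrow> smooth (Dd d g)"
  unfolding smooth_def by (rule usmooth_Dd)

lemma smooth_cong: "smooth g \<Longrightarrow> (\<And>p. p \<in> half \<Longrightarrow> g p = h p) \<Longrightarrow> smooth h"
  unfolding smooth_def by (erule empty.usmooth_cong)

lemma smooth_const: "smooth (\<lambda>p. c)"
  and smooth_snd: "smooth snd"
  and smooth_ln_snd: "smooth (\<lambda>p. ln (snd p))"
  and smooth_add: "smooth g \<Longrightarrow> smooth h \<Longrightarrow> smooth (\<lambda>p. g p + h p)"
  and smooth_mult: "smooth g \<Longrightarrow> smooth h \<Longrightarrow> smooth (\<lambda>p. g p * h p)"
  and smooth_uminus: "smooth g \<Longrightarrow> smooth (\<lambda>p. - g p)"
  and smooth_diff: "smooth g \<Longrightarrow> smooth h \<Longrightarrow> smooth (\<lambda>p. g p - h p)"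
  and smooth_power: "smooth g \<Longrightarrow> smooth (\<lambda>p. g p ^ k)"
  and smooth_exp: "smooth g \<Longrightarrow> smooth (\<lambda>p. exp (g p))"
  unfolding smooth_def by (auto intro: empty.usmooth_intros)

lemma smooth_sum: "(\<And>i. i \<in> I \<Longrightarrow> smooth (g i)) \<Longrightarrow> smooth (\<lambda>p. \<Sum>i\<in>I. g i p)"
  unfolding smooth_def by (rule empty.usmooth_sum)

lemma smooth_ln: "smooth g \<Longrightarrow> (\<And>p. p \<in> half \<Longrightarrow> g p > 0) \<Longrightarrow> smooth (\<lambda>p. ln (g p))"
  and smooth_inverse: "smooth g \<Longrightarrow> (\<And>p. p \<in> half \<Longrightarrow> g p > 0) \<Longrightarrow> smooth (\<lambda>p. inverse (g p))"
  unfolding smooth_def by (auto intro!: empty.usmooth_ln empty.usmooth_inverse simp: ubdd_def)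

lemmas smooth_intros = smooth_const smooth_snd smooth_ln_snd smooth_add smooth_mult smooth_uminus
  smooth_diff smooth_power smooth_exp smooth_sum smooth_Dd

text \<open>Forgets the bounds: the constant sequence with value g N inherits differentiability of
  all orders.\<close>

lemma usmooth_family_smooth:
  fixes g :: "nat \<Rightarrow> (real^'n::finite) \<times> real \<Rightarrow> real"
  assumes "usmooth K g" "N \<ge> 3"
  shows "smooth (g N)"
proof -
  have "bfam {} k (\<lambda>M. h)" if "bfam K k g" "h = g N" for k h and g :: "nat \<Rightarrow> (real^'n) \<times> real \<Rightarrow> real"
    using that
  proof (induction k arbitrary: g h)
    case 0
    then show ?case using assms(2) by (auto simp: ubdd_def)
  next
    case (Suc k)
    have "bfam {} k (\<lambda>M. Dd d h)" for d
      by (rule Suc.IH[of "\<lambda>N. Dd d (g N)"]) (use Suc.prems in auto)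
    then show ?case using Suc.prems assms(2) by (auto simp: ubdd_def)
  qed
  then show ?thesis using assms(1) by (auto simp: smooth_def usmooth_def)
qed

lemma smooth_half_iff: "smooth_half g \<longleftrightarrow> smooth g"
proof
  assume g: "smooth_half g"
  have "diffable (Dit ds g)" for ds
    using g open_half unfolding smooth_half_def diffable_def half_def[symmetric] differentiable_on_def
    by (metis at_within_open)
  then have "bfam {} k (\<lambda>N. Dit ds g)" for k ds
    by (induction k arbitrary: ds) (auto simp: ubdd_def Dit_Cons[symmetric])
  from this[of _ "[]"] show "smooth g" by (simp add: smooth_def usmooth_def)
next
  assume g: "smooth g"
  have "smooth (Dit ds g)" for ds
    by (induction ds) (auto simp: Dit_Cons g smooth_Dd simp del: Dit.simps(2,3))
  then have "diffable (Dit ds g)" for ds by (rule smooth_diffable)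
  then show "smooth_half g"
    unfolding smooth_half_def diffable_def half_def differentiable_on_def
    by (metis differentiable_at_withinI)
qed

text \<open>Converts the boundedness hypothesis on f. The induction over the order leaves the list
  of directions already taken arbitrary.\<close>

lemma usmooth_of_bounded_Dit:
  assumes "smooth g" "\<And>ds. bounded (Dit ds g ` K)"
  shows "usmooth K (\<lambda>N. g)"
proof -
  have "smooth (Dit ds g)" for ds
    by (induction ds) (auto simp: Dit_Cons assms smooth_Dd simp del: Dit.simps(2,3))
  then have d: "diffable (Dit ds g)" for ds by (rule smooth_diffable)
  have b: "ubdd K (\<lambda>N. Dit ds g)" for ds
    using assms(2)[of ds] by (auto simp: bounded_iff ubdd_def)
  have "bfam K k (\<lambda>N. Dit ds g)" for k ds
    by (induction k arbitrary: ds) (auto simp: d b Dit_Cons[symmetric])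
  from this[of _ "[]"] show ?thesis by (simp add: usmooth_def)
qed

lemma Dd_sum:
  assumes "\<And>i. i \<in> I \<Longrightarrow> smooth (g i)" "p \<in> half"
  shows "Dd d (\<lambda>p. \<Sum>i\<in>I. g i p) p = (\<Sum>i\<in>I. Dd d (g i) p)"
  using assms(1)
proof (induction I rule: infinite_finite_induct)
  case (insert i I)
  then show ?case
    by (simp add: Dd_add[OF smooth_diffable smooth_diffable] smooth_sum assms(2))
qed auto

lemma Dd_smooth_commute: "smooth g \<Longrightarrow> p \<in> half \<Longrightarrow> Dd c (Dd d g) p = Dd d (Dd c g) p"
  by (intro Dd_commute) (auto intro: smooth_diffable smooth_Dd)

lemmas sDd_add = Dd_add[OF smooth_diffable smooth_diffable]
  and sDd_mult = Dd_mult[OF smooth_diffable smooth_diffable]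
  and sDd_cmult = Dd_cmult[OF smooth_diffable]

lemma Dd2_add:
  assumes "smooth g" "smooth h" "p \<in> half"
  shows "Dd c (Dd d (\<lambda>p. g p + h p)) p = Dd c (Dd d g) p + Dd c (Dd d h) p"
  by (subst Dd_cong[where h = "\<lambda>p. Dd d g p + Dd d h p"]) (auto simp: sDd_add smooth_Dd assms)

lemma Dd2_mult:
  assumes "smooth g" "smooth h" "p \<in> half"
  shows "Dd d (Dd d (\<lambda>p. g p * h p)) p
           = g p * Dd d (Dd d h) p + 2 * (Dd d g p * Dd d h p) + h p * Dd d (Dd d g) p"
  by (subst Dd_cong[where h = "\<lambda>p. g p * Dd d h p + h p * Dd d g p"])
     (auto simp: sDd_add sDd_mult smooth_intros assms)

text \<open>For a heat solution u = t^(-n/2) e^(-f) this is the heat operator applied to g u,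
  divided by u. The drift 2 grad f . grad g comes from grad u = -u grad f; see
  \<open>heatop_mult_u\<close>.\<close>

definition Lop :: "((real^'n::finite) \<times> real \<Rightarrow> real) \<Rightarrow> ((real^'n) \<times> real \<Rightarrow> real) \<Rightarrow> (real^'n) \<times> real \<Rightarrow> real" where
  "Lop f g p = Dd DT g p - (\<Sum>i\<in>UNIV. Dd (DX i) (Dd (DX i) g) p)
                + 2 * (\<Sum>i\<in>UNIV. Dd (DX i) f p * Dd (DX i) g p)"

lemma Lop_cong:
  assumes "\<And>q. q \<in> half \<Longrightarrow> g q = h q" "p \<in> half"
  shows "Lop f g p = Lop f h p"
proof -
  have 1: "Dd d g q = Dd d h q" if "q \<in> half" for d q
    by (rule Dd_cong) (use assms that in auto)
  have 2: "Dd d (Dd d g) p = Dd d (Dd d h) p" for d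
    by (rule Dd_cong) (use assms 1 in auto)
  show ?thesis unfolding Lop_def by (simp add: 1 2 assms(2))
qed

lemma Lop_add:
  "smooth g \<Longrightarrow> smooth h \<Longrightarrow> p \<in> half \<Longrightarrow> Lop f (\<lambda>p. g p + h p) p = Lop f g p + Lop f h p"
  by (simp add: Lop_def sDd_add Dd2_add sum.distrib distrib_left)

text \<open>The term -2 grad g . grad h is the Leibniz defect of a second-order operator; it is the
  source of |Hess f|^2 in the Bochner computation.\<close>

lemma Lop_mult:
  assumes "smooth g" "smooth h" "p \<in> half"
  shows "Lop f (\<lambda>p. g p * h p) p
           = g p * Lop f h p + h p * Lop f g p - 2 * (\<Sum>i\<in>UNIV. Dd (DX i) g p * Dd (DX i) h p)"
  by (simp add: Lop_def sDd_mult Dd2_mult assms sum.distrib sum_distrib_left algebra_simps)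

lemma Lop_const: "Lop f (\<lambda>p. c) p = 0"
proof -
  have "Dd d (\<lambda>p. c) = (\<lambda>p. 0)" for d :: "'a dir" by (simp add: fun_eq_iff)
  then show ?thesis by (simp add: Lop_def)
qed

lemma Lop_snd: "Lop f snd p = 1"
proof -
  have "Dd d snd = (\<lambda>p. if d = DT then 1 else 0)" for d :: "'a dir" by (simp add: fun_eq_iff Dd_snd)
  then show ?thesis by (simp add: Lop_def)
qed

lemma Lop_sum:
  assumes "\<And>i. i \<in> I \<Longrightarrow> smooth (g i)" "p \<in> half"
  shows "Lop f (\<lambda>p. \<Sum>i\<in>I. g i p) p = (\<Sum>i\<in>I. Lop f (g i) p)"
  using assms(1)
proof (induction I rule: infinite_finite_induct)
  case (insert i I)
  then show ?case by (simp add: Lop_add smooth_sum assms(2))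
qed (auto simp: Lop_const)

section \<open>The equations satisfied by f and the Bochner identity for the parabolic
  deficit\<close>

locale heat_solution =
  fixes u f :: "(real^'n::finite) \<times> real \<Rightarrow> real"
  assumes u_pos: "\<And>p. p \<in> half \<Longrightarrow> u p > 0"
    and u_smooth: "smooth u"
    and heat: "\<And>p. p \<in> half \<Longrightarrow> Dd DT u p = (\<Sum>i\<in>UNIV. Dd (DX i) (Dd (DX i) u) p)"
    and u_eq: "\<And>p. p \<in> half \<Longrightarrow> u p = snd p powr (- real CARD('n) / 2) * exp (- f p)"
begin

lemma u_eq_exp: "p \<in> half \<Longrightarrow> u p = exp ((- real CARD('n) / 2) * ln (snd p) + (-1) * f p)"
  by (simp add: u_eq half_iff powr_def exp_add[symmetric])

text \<open>Smoothness passes from u to f because f = -(n/2) ln t - ln u and u > 0.\<close>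

lemma f_smooth: "smooth f"
proof -
  have "smooth (\<lambda>p. (- real CARD('n) / 2) * ln (snd p) + (-1) * ln (u p))"
    by (intro smooth_intros smooth_ln u_smooth u_pos)
  then show ?thesis by (rule smooth_cong) (simp add: u_eq_exp)
qed

lemma Dd_u_eq:
  assumes "p \<in> half"
  shows "Dd d u p = u p * Dd d (\<lambda>p. (- real CARD('n) / 2) * ln (snd p) + (-1) * f p) p"
proof -
  let ?w = "\<lambda>p. (- real CARD('n) / 2) * ln (snd p) + (-1) * f p"
  have "Dd d u p = Dd d (\<lambda>p. exp (?w p)) p" by (rule Dd_cong) (use assms u_eq_exp in auto)
  also have "\<dots> = exp (?w p) * Dd d ?w p"
    by (intro Dd_compose smooth_diffable smooth_intros f_smooth assms) (auto intro!: derivative_eq_intros)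
  finally show ?thesis using u_eq_exp assms by simp
qed

lemma Dd_ln_snd: "p \<in> half \<Longrightarrow> Dd d (\<lambda>p. ln (snd p)) p = (if d = DT then 1 / snd p else 0)"
  by (subst Dd_compose[where D = "1 / snd p"]) (auto simp: half_iff Dd_snd intro!: derivative_eq_intros)

lemma Dx_u: "p \<in> half \<Longrightarrow> Dd (DX i) u p = - (u p * Dd (DX i) f p)"
  by (simp only: Dd_u_eq sDd_add sDd_cmult smooth_intros f_smooth Dd_ln_snd) simp

lemma Dt_u: "p \<in> half \<Longrightarrow> Dd DT u p = u p * (- real CARD('n) / (2 * snd p) - Dd DT f p)"
  by (simp only: Dd_u_eq sDd_add sDd_cmult smooth_intros f_smooth Dd_ln_snd) simp

lemma Dxx_u:
  assumes "p \<in> half"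
  shows "Dd (DX i) (Dd (DX i) u) p = u p * ((Dd (DX i) f p)\<^sup>2 - Dd (DX i) (Dd (DX i) f) p)"
proof -
  have "Dd (DX i) (Dd (DX i) u) p = Dd (DX i) (\<lambda>p. (-1) * (u p * Dd (DX i) f p)) p"
    by (rule Dd_cong) (auto simp: Dx_u assms)
  also have "\<dots> = (-1) * (u p * Dd (DX i) (Dd (DX i) f) p + Dd (DX i) f p * Dd (DX i) u p)"
    by (simp only: sDd_cmult sDd_mult assms smooth_intros f_smooth u_smooth)
  finally show ?thesis using assms by (simp add: Dx_u algebra_simps power2_eq_square)
qed

lemma Dt_f:
  assumes "p \<in> half"
  shows "Dd DT f p = (\<Sum>i\<in>UNIV. Dd (DX i) (Dd (DX i) f) p) - (\<Sum>i\<in>UNIV. (Dd (DX i) f p)\<^sup>2)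
           - real CARD('n) / (2 * snd p)"
proof -
  have "u p * (- real CARD('n) / (2 * snd p) - Dd DT f p)
      = u p * ((\<Sum>i\<in>UNIV. (Dd (DX i) f p)\<^sup>2) - (\<Sum>i\<in>UNIV. Dd (DX i) (Dd (DX i) f) p))"
    using heat[OF assms] assms by (simp add: Dt_u Dxx_u sum_distrib_left sum_subtractf right_diff_distrib)
  then show ?thesis using u_pos[OF assms] by simp
qed

lemma Lop_f: "p \<in> half \<Longrightarrow> Lop f f p = (\<Sum>i\<in>UNIV. (Dd (DX i) f p)\<^sup>2) - real CARD('n) / (2 * snd p)"
  by (simp add: Lop_def Dt_f power2_eq_square)

text \<open>\<open>Lop f\<close> is the linearization at f of the equation \<open>Dt_f\<close>.
  Differentiating that equation in any direction therefore leaves only the derivative of the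
  explicit term n/(2t).\<close>

lemma Lop_Dd_f:
  assumes p: "p \<in> half"
  shows "Lop f (Dd c f) p = - Dd c (\<lambda>p. real CARD('n) / 2 * inverse (snd p)) p"
proof -
  have sinv: "smooth (\<lambda>p. inverse (snd p))"
    by (intro smooth_inverse smooth_snd) (simp add: half_iff)
  note sm = smooth_intros f_smooth sinv
  have "Dd DT (Dd c f) p = Dd c (Dd DT f) p" by (rule Dd_smooth_commute[OF f_smooth p])
  also have "\<dots> = Dd c (\<lambda>p. (\<Sum>i\<in>UNIV. Dd (DX i) (Dd (DX i) f) p)
          + ((-1) * (\<Sum>i\<in>UNIV. Dd (DX i) f p * Dd (DX i) f p)
          + (-1) * (real CARD('n) / 2 * inverse (snd p)))) p"
    by (rule Dd_cong[OF _ p]) (simp add: Dt_f power2_eq_square inverse_eq_divide)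
  also have "\<dots> = (\<Sum>i\<in>UNIV. Dd c (Dd (DX i) (Dd (DX i) f)) p)
      + ((-1) * (\<Sum>i\<in>UNIV. Dd (DX i) f p * Dd c (Dd (DX i) f) p + Dd (DX i) f p * Dd c (Dd (DX i) f) p)
      + (-1) * Dd c (\<lambda>p. real CARD('n) / 2 * inverse (snd p)) p)"
    using p by (simp only: sDd_add sDd_cmult[where c = "-1"] sDd_mult Dd_sum sm)
  finally have "Dd DT (Dd c f) p = \<dots>" .
  moreover have "Dd c (Dd (DX i) (Dd (DX i) f)) p = Dd (DX i) (Dd (DX i) (Dd c f)) p" for i
  proof -
    have "Dd c (Dd (DX i) (Dd (DX i) f)) p = Dd (DX i) (Dd c (Dd (DX i) f)) p"
      by (intro Dd_smooth_commute smooth_intros f_smooth p)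
    also have "\<dots> = Dd (DX i) (Dd (DX i) (Dd c f)) p"
      by (rule Dd_cong) (auto simp: Dd_smooth_commute f_smooth p)
    finally show ?thesis .
  qed
  moreover have "Dd c (Dd (DX i) f) p = Dd (DX i) (Dd c f) p" for i
    by (rule Dd_smooth_commute[OF f_smooth p])
  ultimately show ?thesis
    unfolding Lop_def by (simp add: sum.distrib[symmetric] sum_distrib_left)
qed

lemma Lop_Dx_f: "p \<in> half \<Longrightarrow> Lop f (Dd (DX i) f) p = 0"
  and Lop_Dt_f: "p \<in> half \<Longrightarrow> Lop f (Dd DT f) p = real CARD('n) / (2 * (snd p)\<^sup>2)"
proof -
  have "Dd c (\<lambda>p. real CARD('n) / 2 * inverse (snd p)) p
      = - (if c = DT then real CARD('n) / (2 * (snd p)\<^sup>2) else 0)" if "p \<in> half" for p and c :: "'n dir"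
    by (subst Dd_compose[where D = "- real CARD('n) / (2 * (snd p)\<^sup>2)" and \<phi> = "\<lambda>z. real CARD('n) / 2 * inverse z"])
      (use that in \<open>auto simp: half_iff Dd_snd power2_eq_square field_simps intro!: derivative_eq_intros\<close>)
  then show "p \<in> half \<Longrightarrow> Lop f (Dd (DX i) f) p = 0"
    "p \<in> half \<Longrightarrow> Lop f (Dd DT f) p = real CARD('n) / (2 * (snd p)\<^sup>2)"
    by (simp_all add: Lop_Dd_f)
qed

lemma D0_eq:
  assumes "p \<in> half"
  shows "D0 f p = snd p * ((\<Sum>i\<in>UNIV. Dd (DX i) f p * Dd (DX i) f p) + 2 * Dd DT f p) + f p"
  using assms by (simp add: D0_def pdx_eq_Dd pdt_eq_Dd sDd_mult smooth_snd f_smooth Dd_snd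
      power2_eq_square algebra_simps)

lemma D0_smooth: "smooth (D0 f)"
proof -
  have "smooth (\<lambda>p. snd p * ((\<Sum>i\<in>UNIV. Dd (DX i) f p * Dd (DX i) f p) + 2 * Dd DT f p) + f p)"
    by (intro smooth_intros f_smooth)
  then show ?thesis by (rule smooth_cong) (simp add: D0_eq)
qed

text \<open>The x-derivatives of f are annihilated by \<open>Lop f\<close>, so |grad f|^2 yields
  only -2 |Hess f|^2; the remaining terms complete the square around I/(2t).\<close>

lemma Lop_D0:
  assumes p: "p \<in> half"
  shows "Lop f (D0 f) p = - 2 * snd p * (\<Sum>i\<in>UNIV. \<Sum>j\<in>UNIV.
           (Dd (DX i) (Dd (DX j) f) p - (if i = j then 1 / (2 * snd p) else 0))\<^sup>2)"
proof -
  let ?t = "snd p" and ?n = "real CARD('n)"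
  let ?G = "\<Sum>i\<in>UNIV. (Dd (DX i) f p)\<^sup>2"
  let ?L = "\<Sum>i\<in>UNIV. Dd (DX i) (Dd (DX i) f) p"
  let ?H = "\<Sum>i\<in>UNIV. \<Sum>j\<in>UNIV. (Dd (DX i) (Dd (DX j) f) p)\<^sup>2"
  have t: "?t > 0" using p by (simp add: half_iff)
  note sm = smooth_intros f_smooth
  have LS: "Lop f (\<lambda>p. \<Sum>i\<in>UNIV. Dd (DX i) f p * Dd (DX i) f p) p = - 2 * ?H"
    using p by (simp add: Lop_sum Lop_mult Lop_Dx_f sm sum_negf sum_distrib_left power2_eq_square)
      (subst sum.swap, simp)
  have Dg: "Dd (DX i) snd p = 0" for i by (simp add: Dd_snd)
  have "Lop f (D0 f) p = Lop f (\<lambda>p. snd p * ((\<Sum>i\<in>UNIV. Dd (DX i) f p * Dd (DX i) f p) + 2 * Dd DT f p) + f p) p"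
    by (rule Lop_cong) (auto simp: D0_eq p)
  also have "\<dots> = ?t * (- 2 * ?H + 2 * (?n / (2 * ?t\<^sup>2))) + (?G + 2 * Dd DT f p) + Lop f f p"
    using p by (simp add: Lop_add Lop_mult[of snd] Lop_mult[of "\<lambda>_. 2"] LS Lop_Dt_f Lop_const Lop_snd Dg sm power2_eq_square)
  \<comment> \<open>Substituting \<open>Dt_f\<close> for the time derivative cancels |grad f|^2 and
    leaves the trace of the Hessian.\<close>
  also have "\<dots> = - 2 * ?t * ?H + 2 * ?L - ?n / (2 * ?t)"
    using p t by (simp add: Lop_f Dt_f field_simps power2_eq_square)
  also have "\<dots> = - 2 * ?t * (?H - ?L / ?t + ?n / (4 * ?t\<^sup>2))"
    using t by (simp add: field_simps power2_eq_square)
  also have "?H - ?L / ?t + ?n / (4 * ?t\<^sup>2) = (\<Sum>i\<in>UNIV. \<Sum>j\<in>UNIV. (Dd (DX i) (Dd (DX j) f) p)\<^sup>2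
      + (if i = j then 1 / (4 * ?t\<^sup>2) - Dd (DX i) (Dd (DX j) f) p / ?t else 0))"
    by (simp add: sum.distrib sum_subtractf sum_divide_distrib)
  also have "\<dots> = (\<Sum>i\<in>UNIV. \<Sum>j\<in>UNIV.
           (Dd (DX i) (Dd (DX j) f) p - (if i = j then 1 / (2 * snd p) else 0))\<^sup>2)"
    by (intro sum.cong refl) (use t in \<open>auto simp: power2_diff power_divide\<close>)
  finally show ?thesis .
qed

lemma heatop_mult_u:
  assumes g: "smooth g" and p: "p \<in> half"
  shows "heatop (\<lambda>q. g q * u q) p = u p * Lop f g p"
  using heat[OF p]
  by (simp add: heatop_def pdx_eq_Dd pdt_eq_Dd Lop_def sDd_mult Dd2_mult g u_smooth p Dx_u
      sum.distrib sum_distrib_left sum_negf sum_subtractf algebra_simps)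

end

section \<open>Expansion in powers of \<open>1/N\<close>\<close>

text \<open>The small parameter of all expansions: b = |y| e^(a f).\<close>

definition acoef :: "'n::finite itself \<Rightarrow> nat \<Rightarrow> real" where
  "acoef _ N = 1 / (mdim TYPE('n) N - 2)"

lemma CARD_ge_1: "real CARD('n::finite) \<ge> 1"
  by (metis One_nat_def Suc_leI of_nat_1 of_nat_mono zero_less_card_finite)

context
  fixes N :: nat
  assumes N: "N \<ge> 3"
begin

lemma mdim_bounds: "mdim TYPE('n::finite) N - 2 \<ge> 2" "mdim TYPE('n) N - 2 \<ge> real N - 1"
    "mdim TYPE('n) N \<ge> real N" "mdim TYPE('n) N > 0"
proof -
  have "real N \<ge> 3" using N by simp
  then show "mdim TYPE('n::finite) N - 2 \<ge> 2" "mdim TYPE('n) N - 2 \<ge> real N - 1"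
    "mdim TYPE('n) N \<ge> real N" "mdim TYPE('n) N > 0"
    using CARD_ge_1[where 'n = 'n] unfolding mdim_def of_nat_add by linarith+
qed

lemma acoef_pos: "acoef TYPE('n::finite) N > 0"
  using mdim_bounds[where 'n = 'n] by (simp add: acoef_def)

lemma acoef_le: "acoef TYPE('n::finite) N \<le> 1"
  using mdim_bounds[where 'n = 'n] by (simp add: acoef_def)

lemma N_acoef_le: "real N * acoef TYPE('n::finite) N \<le> 2"
  using mdim_bounds[where 'n = 'n] N by (simp add: acoef_def field_simps)

text \<open>This and \<open>N_acoef\<close> replace the large factors m and N, once multiplied by a,
  by 1 plus an explicit multiple of a.\<close>

lemma mdim_acoef: "mdim TYPE('n::finite) N * acoef TYPE('n) N = 1 + 2 * acoef TYPE('n) N"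
  using mdim_bounds[where 'n = 'n] by (simp add: acoef_def field_simps)

lemma N_acoef: "real N * acoef TYPE('n::finite) N = 1 - (real CARD('n) - 2) * acoef TYPE('n) N"
  using mdim_bounds[where 'n = 'n] by (simp add: acoef_def mdim_def field_simps)

end

section \<open>Taylor remainders of the exponential\<close>

lemma abs_exp_minus_one_le: "\<bar>exp z - 1\<bar> \<le> \<bar>z\<bar> * exp \<bar>z\<bar>" for z :: real
proof -
  have 1: "z \<le> exp z - 1" using exp_ge_add_one_self[of z] by linarith
  have "exp z * (1 + - z) \<le> exp z * exp (- z)"
    by (intro mult_left_mono exp_ge_add_one_self) auto
  then have 2: "exp z - 1 \<le> z * exp z" by (simp add: exp_minus field_simps)
  have 3: "\<bar>z\<bar> \<le> \<bar>z\<bar> * exp \<bar>z\<bar>" by (rule mult_le_cancel_left1[THEN iffD2]) auto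
  have 4: "z * exp z \<le> \<bar>z\<bar> * exp \<bar>z\<bar>" by (intro mult_mono) auto
  show ?thesis using 1 2 3 4 by linarith
qed

text \<open>Both bounds come from 1 + x \<le> e^x at x = z and x = -z. Here the second instance
  gives e^z - 1 - z \<le> z (e^z - 1), and the first-order bound finishes.\<close>

lemma abs_exp_minus_one_minus_le: "\<bar>exp z - 1 - z\<bar> \<le> z\<^sup>2 * exp \<bar>z\<bar>" for z :: real
proof -
  have 1: "0 \<le> exp z - 1 - z" using exp_ge_add_one_self[of z] by linarith
  have "exp z * (1 + - z) \<le> exp z * exp (- z)"
    by (intro mult_left_mono exp_ge_add_one_self) auto
  then have "exp z - 1 - z \<le> z * (exp z - 1)" by (simp add: exp_minus field_simps)
  also have "\<dots> \<le> \<bar>z\<bar> * \<bar>exp z - 1\<bar>" using abs_ge_self[of "z * (exp z - 1)"] by (simp add: abs_mult)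
  also have "\<dots> \<le> \<bar>z\<bar> * (\<bar>z\<bar> * exp \<bar>z\<bar>)" by (intro mult_left_mono abs_exp_minus_one_le) auto
  finally show ?thesis using 1 by (simp add: power2_eq_square abs_mult[symmetric])
qed

lemma ubdd_seq: "(\<And>N. N \<ge> 3 \<Longrightarrow> \<bar>c N\<bar> \<le> C) \<Longrightarrow> ubdd K (\<lambda>N p. c N)"
  by (intro ubddI) auto

text \<open>\<open>a N\<close> may tend to 0; the Taylor bounds supply the powers of it lost in the
  division, and a N \<le> 1 keeps the exponentials below e^C.\<close>

lemma ubdd_exp_quotients:
  assumes g: "ubdd K (\<lambda>N. g)" and a: "\<And>N. N \<ge> 3 \<Longrightarrow> a N > 0 \<and> a N \<le> 1"
  shows "ubdd K (\<lambda>N p. (exp (a N * g p) - 1) / a N)"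
    and "ubdd K (\<lambda>N p. ((exp (a N * g p) - 1) / a N - g p) / a N)"
proof -
  obtain C where C: "C \<ge> 0" "\<And>p. p \<in> K \<Longrightarrow> \<bar>g p\<bar> \<le> C"
    using ubddE[OF g] by (metis order_refl)
  have *: "exp \<bar>a N * g p\<bar> \<le> exp C" if "N \<ge> 3" "p \<in> K" for N p
  proof -
    have "\<bar>a N * g p\<bar> \<le> 1 * C" unfolding abs_mult using a[of N] C that by (intro mult_mono) auto
    then show ?thesis by simp
  qed
  show "ubdd K (\<lambda>N p. (exp (a N * g p) - 1) / a N)"
  proof (rule ubddI)
    fix N :: nat and p assume N: "N \<ge> 3" "p \<in> K"
    have "\<bar>exp (a N * g p) - 1\<bar> \<le> \<bar>a N * g p\<bar> * exp \<bar>a N * g p\<bar>" by (rule abs_exp_minus_one_le)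
    also have "\<dots> = a N * (\<bar>g p\<bar> * exp \<bar>a N * g p\<bar>)" using a[OF N(1)] by (simp add: abs_mult)
    also have "\<dots> \<le> a N * (C * exp C)" using a[OF N(1)] N C *[OF N] by (intro mult_left_mono mult_mono) auto
    finally show "\<bar>(exp (a N * g p) - 1) / a N\<bar> \<le> C * exp C"
      using a[OF N(1)] by (simp add: field_simps)
  qed
  show "ubdd K (\<lambda>N p. ((exp (a N * g p) - 1) / a N - g p) / a N)"
  proof (rule ubddI)
    fix N :: nat and p assume N: "N \<ge> 3" "p \<in> K"
    have "\<bar>exp (a N * g p) - 1 - a N * g p\<bar> \<le> (a N * g p)\<^sup>2 * exp \<bar>a N * g p\<bar>"
      by (rule abs_exp_minus_one_minus_le)
    also have "\<dots> = (a N)\<^sup>2 * (\<bar>g p\<bar>\<^sup>2 * exp \<bar>a N * g p\<bar>)" by (simp add: power_mult_distrib)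
    also have "\<dots> \<le> (a N)\<^sup>2 * (C\<^sup>2 * exp C)" using a[OF N(1)] N C *[OF N] by (intro mult_left_mono mult_mono power_mono) auto
    finally have "\<bar>exp (a N * g p) - 1 - a N * g p\<bar> / (a N)\<^sup>2 \<le> C\<^sup>2 * exp C"
      using a[OF N(1)] by (simp add: field_simps)
    moreover have "((exp (a N * g p) - 1) / a N - g p) / a N = (exp (a N * g p) - 1 - a N * g p) / (a N)\<^sup>2"
      using a[OF N(1)] by (simp add: field_simps power2_eq_square)
    ultimately show "\<bar>((exp (a N * g p) - 1) / a N - g p) / a N\<bar> \<le> C\<^sup>2 * exp C"
      by simp
  qed
qed

lemma Dd2_cmult:
  assumes "smooth g" "p \<in> half"
  shows "Dd c (Dd d (\<lambda>p. k * g p)) p = k * Dd c (Dd d g) p"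
  by (subst Dd_cong[where h = "\<lambda>p. k * Dd d g p"]) (auto simp: sDd_cmult smooth_Dd assms)

definition tpow :: "real \<Rightarrow> (real^'n::finite) \<times> real \<Rightarrow> real" where
  "tpow c p = exp (c * ln (snd p))"

lemma tpow_smooth: "smooth (tpow c)"
  unfolding tpow_def by (intro smooth_intros)

lemma Dd_tpow:
  assumes "p \<in> half"
  shows "Dd d (tpow c) p = (if d = DT then c / snd p * tpow c p else 0)"
  unfolding tpow_def
  by (subst Dd_compose[where D = "c / snd p * tpow c p" and \<phi> = "\<lambda>z. exp (c * ln z)"])
    (use assms in \<open>auto simp: half_iff Dd_snd tpow_def intro!: derivative_eq_intros\<close>)

lemma Dt2_tpow:
  assumes p: "p \<in> half"
  shows "Dd DT (Dd DT (tpow c)) p = c * (c - 1) / (snd p)\<^sup>2 * tpow c p"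
proof -
  have "Dd DT (Dd DT (tpow c)) p = Dd DT (\<lambda>p. c * tpow (c - 1) p) p"
    by (rule Dd_cong[OF _ p])
      (auto simp: Dd_tpow half_iff tpow_def left_diff_distrib exp_diff)
  also have "\<dots> = c * (c - 1) / (snd p)\<^sup>2 * tpow c p"
    using p by (simp add: sDd_cmult tpow_smooth Dd_tpow half_iff)
      (simp add: tpow_def left_diff_distrib exp_diff power2_eq_square)
  finally show ?thesis .
qed

lemma Dx2_tpow:
  assumes p: "p \<in> half"
  shows "Dd (DX i) (Dd (DX i) (tpow c)) p = 0"
proof -
  have "Dd (DX i) (Dd (DX i) (tpow c)) p = Dd (DX i) (\<lambda>p. 0) p"
    by (rule Dd_cong[OF _ p]) (simp add: Dd_tpow)
  then show ?thesis by simp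
qed

text \<open>The weight \<open>t\<^bsup>(2-N)/2\<^esup>\<close> is a multiple of \<open>|y|\<^bsup>2-N\<^esup>\<close>, which is harmonic on
  \<open>\<real>\<^sup>N\<close>; its gradient turns the \<open>+\<partial>\<^sub>t\<close> of the unweighted Laplacian into \<open>-\<partial>\<^sub>t\<close>.\<close>

lemma lapm_weighted:
  assumes h: "smooth h" and t: "tau N (snd p) > 0" and N: "N > 0"
  defines "q \<equiv> proj N p"
  shows "lapm N (\<lambda>p. tpow ((2 - real N) / 2) (proj N p) * h (proj N p)) p
      = tpow ((2 - real N) / 2) q * ((\<Sum>i\<in>UNIV. Dd (DX i) (Dd (DX i) h) q) - Dd DT h q
           + (4 * Dd DT h q + 2 * snd q * Dd DT (Dd DT h) q) / real N)"
proof -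
  define c where "c = (2 - real N) / 2"
  have c: "real N = 2 - 2 * c" by (simp add: c_def field_simps)
  have q: "q \<in> half" "snd q > 0" using proj_half[OF t] by (auto simp: q_def half_iff)
  define A B C T where "A = h q" "B = Dd DT h q" "C = Dd DT (Dd DT h) q" "T = snd q"
  have sm: "smooth (\<lambda>q. tpow c q * h q)" by (intro smooth_mult tpow_smooth h)
  have "lapm N (\<lambda>p. tpow c (proj N p) * h (proj N p)) p
      = (\<Sum>i\<in>UNIV. Dd (DX i) (Dd (DX i) (\<lambda>q. tpow c q * h q)) q) + Dd DT (\<lambda>q. tpow c q * h q) q
       + 2 * snd q / real N * Dd DT (Dd DT (\<lambda>q. tpow c q * h q)) q"
    unfolding q_def
    by (rule lapm_proj[of "\<lambda>q. tpow c q * h q"]) (intro smooth_diffable smooth_Dd sm t)+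
  also have "(\<Sum>i\<in>UNIV. Dd (DX i) (Dd (DX i) (\<lambda>q. tpow c q * h q)) q)
      = tpow c q * (\<Sum>i\<in>UNIV. Dd (DX i) (Dd (DX i) h) q)"
    using q by (simp add: Dd2_mult tpow_smooth h Dd_tpow Dx2_tpow sum_distrib_left)
  also have "Dd DT (\<lambda>q. tpow c q * h q) q = tpow c q * (B + c / T * A)"
    using q by (simp add: sDd_mult tpow_smooth h Dd_tpow A_B_C_T_def distrib_left)
  also have "Dd DT (Dd DT (\<lambda>q. tpow c q * h q)) q
      = tpow c q * (C + 2 * (c / T) * B + c * (c - 1) / T\<^sup>2 * A)"
    using q by (simp add: Dd2_mult tpow_smooth h Dd_tpow Dt2_tpow A_B_C_T_def distrib_left mult_ac)
  finally have "lapm N (\<lambda>p. tpow c (proj N p) * h (proj N p)) p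
    = tpow c q * ((\<Sum>i\<in>UNIV. Dd (DX i) (Dd (DX i) h) q) + ((B + c / T * A)
       + 2 * T / real N * (C + 2 * (c / T) * B + c * (c - 1) / T\<^sup>2 * A)))"
    by (simp add: A_B_C_T_def algebra_simps)
  \<comment> \<open>Since 2(c-1) = -N, the coefficient of h is (c/T)(1 + 2(c-1)/N) = 0, which is the
    harmonicity of the weight; that of its time derivative is 1 + 4c/N = -1 + 4/N.\<close>
  also have "(B + c / T * A) + 2 * T / real N * (C + 2 * (c / T) * B + c * (c - 1) / T\<^sup>2 * A)
    = - B + (4 * B + 2 * T * C) / real N"
    using q(2) N unfolding A_B_C_T_def(4)[symmetric] of_nat_0_less_iff[where 'a = real, symmetric] c
    by (simp add: divide_simps power2_eq_square) (simp add: algebra_simps)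
  finally show ?thesis by (simp add: A_B_C_T_def c_def)
qed

locale strip_solution = heat_solution u f + half_region K
  for u f :: "(real^'n::finite) \<times> real \<Rightarrow> real" and K :: "((real^'n) \<times> real) set" +
  fixes a :: "nat \<Rightarrow> real"
  assumes a_def: "a = acoef TYPE('n)"
    and f_usmooth: "usmooth K (\<lambda>N. f)"
begin

lemma
  assumes "N \<ge> 3"
  shows a_pos: "a N > 0" and a_le: "a N \<le> 1" and Na_le: "real N * a N \<le> 2"
    and ma: "mdim TYPE('n) N * a N = 1 + 2 * a N"
    and Na: "real N * a N = 1 - (real CARD('n) - 2) * a N"
  unfolding a_def using assms by (auto intro: acoef_pos acoef_le N_acoef_le mdim_acoef N_acoef)

text \<open>First and second order remainders of \<open>e\<^bsup>2af\<^esup>\<close>. Derivatives of all orders stay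
  bounded because \<open>DP = 2 Df (1 + aP)\<close> and \<open>DE = 2 Df P\<close>.\<close>

definition P :: "nat \<Rightarrow> (real^'n) \<times> real \<Rightarrow> real" where
  "P N q = (exp (a N * (2 * f q)) - 1) / a N"

definition E :: "nat \<Rightarrow> (real^'n) \<times> real \<Rightarrow> real" where
  "E N q = (P N q - 2 * f q) / a N"

lemma exp_eq_P: "N \<ge> 3 \<Longrightarrow> exp (a N * (2 * f q)) = 1 + a N * P N q"
  using a_pos[of N] by (simp add: P_def)

lemma P_eq_E: "N \<ge> 3 \<Longrightarrow> P N q = 2 * f q + a N * E N q"
  using a_pos[of N] by (simp add: E_def)

lemma usmooth_a: "usmooth K (\<lambda>N p. a N)"
  by (rule usmooth_const_seq[of _ 1]) (use a_pos a_le in \<open>auto simp: abs_of_pos\<close>)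

lemma usmooth_Na: "usmooth K (\<lambda>N p. real N * a N)"
  by (rule usmooth_const_seq[of _ 2]) (use a_pos Na_le in \<open>auto simp: abs_mult abs_of_pos\<close>)

lemma Dd_P:
  assumes N: "N \<ge> 3" and q: "q \<in> half"
  shows "Dd d (P N) q = 2 * Dd d f q * (1 + a N * P N q)"
proof -
  have "Dd d (P N) q = (exp (a N * (2 * f q)) * 2) * Dd d f q"
    unfolding P_def
    by (rule Dd_compose[where \<phi> = "\<lambda>z. (exp (a N * (2 * z)) - 1) / a N"])
      (use q a_pos[OF N] in \<open>auto intro!: smooth_diffable f_smooth derivative_eq_intros\<close>)
  then show ?thesis using N by (simp add: exp_eq_P)
qed

lemma usmooth_P: "usmooth K P"
proof (rule usmoothI)
  show "ubdd K P"
    unfolding P_def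
    by (rule ubdd_exp_quotients(1)[where g = "\<lambda>q. 2 * f q"])
      (use a_pos a_le in \<open>auto intro!: ubdd_intros usmooth_ubdd[OF f_usmooth]\<close>)
  have eq: "P N = (\<lambda>q. (1 / a N) * exp (a N * (2 * f q)) + (- 1 / a N))" for N
    by (auto simp: P_def diff_divide_distrib)
  show sm: "diffable (P N)" if "N \<ge> 3" for N
    unfolding eq by (intro smooth_diffable smooth_intros f_smooth)
  fix k d assume *: "bfam K k P"
  have f: "bfam K k (\<lambda>N q. 2 * Dd d f q)" and a: "bfam K k (\<lambda>N q. a N)" and 1: "bfam K k (\<lambda>N q. 1)"
    using usmooth_intros(3)[OF usmooth_const usmooth_Dd[OF f_usmooth, of d], of 2] usmooth_a
      usmooth_const[of K 1] by (auto simp: usmooth_def)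
  show "bfam K k (\<lambda>N. Dd d (P N))"
  proof (rule bfam_cong[OF bfam_mult[OF f bfam_add[OF 1 bfam_mult[OF a *]]]])
    fix N :: nat and q :: "(real^'n) \<times> real" assume N: "N \<ge> 3" and q: "q \<in> half"
    show "2 * Dd d f q * (1 + a N * P N q) = Dd d (P N) q"
      using N q by (simp add: Dd_P)
  qed
qed

lemma usmooth_E: "usmooth K E"
proof (rule usmoothI)
  show "ubdd K E"
    unfolding E_def P_def
    by (rule ubdd_exp_quotients(2)[where g = "\<lambda>q. 2 * f q"])
      (use a_pos a_le in \<open>auto intro!: ubdd_intros usmooth_ubdd[OF f_usmooth]\<close>)
  have eq: "E N = (\<lambda>q. (1 / a N) * (P N q + (- 2) * f q))" for N
    by (auto simp: E_def)
  show sm: "diffable (E N)" if "N \<ge> 3" for N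
    unfolding eq using usmooth_family_smooth[OF usmooth_P that]
    by (intro smooth_diffable smooth_intros f_smooth)
  fix k d
  have "usmooth K (\<lambda>N q. 2 * Dd d f q * P N q)"
    by (intro usmooth_intros usmooth_P f_usmooth)
  then have "bfam K k (\<lambda>N q. 2 * Dd d f q * P N q)" by (simp add: usmooth_def)
  then show "bfam K k (\<lambda>N. Dd d (E N))"
  proof (rule bfam_cong)
    fix N :: nat and q :: "(real^'n) \<times> real" assume N: "N \<ge> 3" and q: "q \<in> half"
    have "Dd d (E N) q = (1 / a N) * (Dd d (P N) q + (- 2) * Dd d f q)"
      unfolding eq using usmooth_family_smooth[OF usmooth_P N] q
      by (simp only: sDd_cmult sDd_add smooth_intros f_smooth)
    also have "\<dots> = 2 * Dd d f q * P N q"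
      using a_pos[OF N] N q by (simp add: Dd_P field_simps)
    finally show "2 * Dd d f q * P N q = Dd d (E N) q" ..
  qed
qed

lemma usmooth_D0: "usmooth K (\<lambda>N. D0 f)"
proof (rule usmooth_cong)
  show "usmooth K (\<lambda>N p. snd p * ((\<Sum>i\<in>UNIV. Dd (DX i) f p * Dd (DX i) f p) + 2 * Dd DT f p) + f p)"
    by (intro usmooth_intros f_usmooth)
qed (simp add: D0_eq)

lemma usmooth_u: "usmooth K (\<lambda>N. u)"
proof (rule usmooth_cong)
  show "usmooth K (\<lambda>N p. exp ((- real CARD('n) / 2) * ln (snd p) + (-1) * f p))"
    by (intro usmooth_intros f_usmooth)
qed (simp only: u_eq_exp)

lemma ubdd_inverse_u: "ubdd K (\<lambda>N p. inverse (u p))"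
proof (rule ubdd_cong)
  have "usmooth K (\<lambda>N p. exp (- ((- real CARD('n) / 2) * ln (snd p) + (-1) * f p)))"
    by (intro usmooth_intros f_usmooth)
  then show "ubdd K (\<lambda>N p. exp (- ((- real CARD('n) / 2) * ln (snd p) + (-1) * f p)))" by (rule usmooth_ubdd)
qed (simp only: u_eq_exp[OF K_half] exp_minus)

subsection \<open>The functions \<open>v\<close>, \<open>b\<close> and the elliptic deficit\<close>

text \<open>This is b in the variables (x,t), namely sqrt(2Nt) e^(a f).\<close>

definition \<beta> :: "nat \<Rightarrow> (real^'n) \<times> real \<Rightarrow> real" where
  "\<beta> N q = exp (1 / 2 * ln (2 * real N) + (1 / 2 * ln (snd q) + a N * f q))"

definition S :: "(real^'n) \<times> real \<Rightarrow> real" where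
  "S q = (\<Sum>i\<in>UNIV. (Dd (DX i) f q)\<^sup>2)"

text \<open>The elliptic deficit in the variables (x,t); the product from which 1 is subtracted is
  |grad b|^2.\<close>

definition G :: "nat \<Rightarrow> (real^'n) \<times> real \<Rightarrow> real" where
  "G N q = 2 * mdim TYPE('n) N * ((1 + a N * P N q) * (2 * real N * snd q * (a N)\<^sup>2 * S q
             + (1 + 2 * a N * snd q * Dd DT f q)\<^sup>2) - 1)"

text \<open>Chosen so that |grad b|^2 = (1 + a P)(1 + a Y).\<close>

definition Y :: "nat \<Rightarrow> (real^'n) \<times> real \<Rightarrow> real" where
  "Y N q = 2 * (real N * a N) * snd q * S q + 4 * snd q * Dd DT f q + 4 * a N * (snd q)\<^sup>2 * (Dd DT f q)\<^sup>2"

text \<open>N times the deviation of d_0 from 4 D_0. The factor N stands next to an a, so the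
  product stays bounded.\<close>

definition R :: "nat \<Rightarrow> (real^'n) \<times> real \<Rightarrow> real" where
  "R N q = (real N * a N) * (8 * D0 f q + 2 * (1 + 2 * a N) *
      (E N q + (- 2 * (real CARD('n) - 2) * snd q * S q + 4 * (snd q)\<^sup>2 * (Dd DT f q)\<^sup>2) + P N q * Y N q))"

lemma usmooth_S: "usmooth K (\<lambda>N. S)"
  unfolding S_def by (intro usmooth_intros f_usmooth)

lemma usmooth_R: "usmooth K R"
  unfolding R_def Y_def
  by (intro usmooth_intros usmooth_a usmooth_Na usmooth_D0 usmooth_E usmooth_P usmooth_S f_usmooth)

text \<open>2m((1 + aP)(1 + aY) - 1) = 2ma(P + Y + aPY): the factor m uses up one power of a, and P
  + Y is 2 D_0 up to order a.\<close>

lemma G_expansion: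
  assumes N: "N \<ge> 3" and q: "q \<in> half"
  shows "G N q = 4 * D0 f q + (1 / real N) * R N q"
proof -
  define t T s p e where "t = snd q" "T = Dd DT f q" "s = S q" "p = P N q" "e = E N q"
  note defs = this
  define y where "y = Y N q"
  have y: "y = 2 * (real N * a N) * t * s + 4 * t * T + 4 * a N * t\<^sup>2 * T\<^sup>2"
    by (simp add: y_def Y_def defs)
  have D0: "D0 f q = t * (s + 2 * T) + f q"
    using q by (simp add: D0_eq defs S_def power2_eq_square)
  \<comment> \<open>At leading order P supplies 2f and Y supplies 2ts + 4tT, the term in s after N a
    is replaced by 1 - (n-2) a.\<close>
  have py: "p + y = 2 * D0 f q + a N * (e + (- 2 * (real CARD('n) - 2) * t * s + 4 * t\<^sup>2 * T\<^sup>2))"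
    using P_eq_E[OF N, of q] unfolding D0 y Na[OF N]
    by (simp add: defs(4,5)) (simp add: algebra_simps)
  have "2 * real N * t * (a N)\<^sup>2 * s + (1 + 2 * a N * t * T)\<^sup>2 = 1 + a N * y"
    unfolding y by (simp add: power2_eq_square algebra_simps)
  then have "G N q = 2 * mdim TYPE('n) N * ((1 + a N * p) * (1 + a N * y) - 1)"
    by (simp add: G_def defs)
  also have "\<dots> = 2 * (mdim TYPE('n) N * a N) * ((p + y) + a N * (p * y))"
    by (simp add: algebra_simps)
  also have "\<dots> = 2 * (1 + 2 * a N) * ((p + y) + a N * (p * y))"
    unfolding ma[OF N] ..
  also have "\<dots> = 4 * D0 f q + a N * (8 * D0 f q + 2 * (1 + 2 * a N) *
      (e + (- 2 * (real CARD('n) - 2) * t * s + 4 * t\<^sup>2 * T\<^sup>2) + p * y))"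
    unfolding py by (simp add: algebra_simps)
  also have "\<dots> = 4 * D0 f q + (1 / real N) * R N q"
    using N by (simp add: R_def defs y_def)
  finally show ?thesis .
qed

lemma usmooth_G: "usmooth K G"
proof (rule usmooth_cong)
  have "usmooth K (\<lambda>N p. 1 / real N)"
    by (rule usmooth_const_seq[of _ 1]) auto
  then show "usmooth K (\<lambda>N q. 4 * D0 f q + (1 / real N) * R N q)"
    by (intro usmooth_intros usmooth_D0 usmooth_R)
qed (simp add: G_expansion)

lemma \<beta>_sq:
  assumes "N \<ge> 3" "q \<in> half"
  shows "(\<beta> N q)\<^sup>2 = 2 * real N * snd q * (1 + a N * P N q)"
proof -
  have "(\<beta> N q)\<^sup>2 = exp (ln (2 * real N) + (ln (snd q) + a N * (2 * f q)))"
    by (simp add: \<beta>_def power2_eq_square exp_add[symmetric] algebra_simps)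
  also have "\<dots> = 2 * real N * snd q * exp (a N * (2 * f q))"
    unfolding exp_add using assms by (simp add: half_iff)
  finally show ?thesis using exp_eq_P assms by simp
qed

lemma \<beta>_smooth: "smooth (\<beta> N)"
  unfolding \<beta>_def by (intro smooth_intros f_smooth)

lemma Dd_\<beta>:
  assumes "q \<in> half"
  shows "Dd d (\<beta> N) q = \<beta> N q * ((if d = DT then 1 / (2 * snd q) else 0) + a N * Dd d f q)"
proof -
  let ?w = "\<lambda>q. 1 / 2 * ln (2 * real N) + (1 / 2 * ln (snd q) + a N * f q)"
  have "Dd d (\<lambda>q. exp (?w q)) q = exp (?w q) * Dd d ?w q"
    by (intro Dd_compose smooth_diffable smooth_intros f_smooth assms) (auto intro!: derivative_eq_intros)
  also have "Dd d ?w q = (if d = DT then 1 / (2 * snd q) else 0) + a N * Dd d f q"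
    using assms by (simp only: sDd_add sDd_cmult smooth_intros f_smooth Dd_const Dd_ln_snd) simp
  finally show ?thesis by (simp add: \<beta>_def[abs_def])
qed

lemma ln_normy:
  assumes "tau N (snd p) > 0" "N \<ge> 3"
  shows "normy N (snd p) > 0" "ln (normy N (snd p)) = 1 / 2 * ln (2 * real N) + 1 / 2 * ln (snd (proj N p))"
proof -
  have eq: "normy N (snd p) = sqrt (2 * real N * tau N (snd p))"
    using assms by (simp add: normy_def sum_sq_eq_tau)
  then show pos: "normy N (snd p) > 0" using assms by simp
  show "ln (normy N (snd p)) = 1 / 2 * ln (2 * real N) + 1 / 2 * ln (snd (proj N p))"
    unfolding eq proj_def using assms by (simp add: ln_sqrt ln_mult)
qed

lemma vfun_eq_exp:
  assumes "tau N (snd p) > 0" "N \<ge> 3"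
  shows "vfun f N p = exp ((2 - mdim TYPE('n) N) * (1 / 2 * ln (2 * real N) + 1 / 2 * ln (snd (proj N p))) - f (proj N p))"
  using ln_normy[OF assms] unfolding vfun_def powr_def proj_def
  by (simp add: tau_def[symmetric] exp_add[symmetric] exp_minus[symmetric])

text \<open>The constant (2N)^((2-m)/2) in v, which cancels in the quotient of the Laplacian of d_0
  v by v.\<close>

definition vcoef :: "nat \<Rightarrow> real" where
  "vcoef N = exp ((2 - mdim TYPE('n) N) / 2 * ln (2 * real N))"

text \<open>|y|^(2-m) is a constant times t^((2-N)/2) t^(-n/2), and the last factor completes e^(-f)
  to u.\<close>

lemma vfun_eq:
  assumes "tau N (snd p) > 0" "N \<ge> 3"
  shows "vfun f N p = vcoef N * (tpow ((2 - real N) / 2) (proj N p) * u (proj N p))"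
proof -
  have "vcoef N * (tpow ((2 - real N) / 2) (proj N p) * u (proj N p))
    = exp ((2 - mdim TYPE('n) N) / 2 * ln (2 * real N) + ((2 - real N) / 2 * ln (snd (proj N p))
        + ((- real CARD('n) / 2) * ln (snd (proj N p)) + (-1) * f (proj N p))))"
    unfolding vcoef_def tpow_def exp_add u_eq_exp[OF proj_half[OF assms(1)]] ..
  also have "\<dots> = vfun f N p"
    unfolding vfun_eq_exp[OF assms] by (simp add: mdim_def field_simps)
  finally show ?thesis ..
qed

lemma bfun_eq:
  assumes "tau N (snd p) > 0" "N \<ge> 3"
  shows "bfun f N p = \<beta> N (proj N p)"
proof -
  have m: "2 - mdim TYPE('n) N \<noteq> 0" using mdim_bounds[OF assms(2), where 'n = 'n] by simp
  have a: "a N = - (1 / (2 - mdim TYPE('n) N))"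
    unfolding a_def acoef_def using m by (simp add: field_simps)
  have "bfun f N p = exp (1 / (2 - mdim TYPE('n) N) * ((2 - mdim TYPE('n) N) * (1 / 2 * ln (2 * real N) + 1 / 2 * ln (snd (proj N p))) - f (proj N p)))"
    unfolding bfun_def vfun_eq_exp[OF assms] powr_def by simp
  also have "\<dots> = \<beta> N (proj N p)"
    unfolding \<beta>_def a using m by (simp add: field_simps)
  finally show ?thesis .
qed

lemma d0_eq:
  assumes t: "tau N (snd p) > 0" and N: "N \<ge> 3"
  shows "d0 f N p = G N (proj N p)"
proof -
  define q where "q = proj N p"
  have q: "q \<in> half" "snd q > 0" using proj_half[OF t] by (auto simp: q_def half_iff)
  have "gradsq N (bfun f N) p = gradsq N (\<lambda>p. \<beta> N (proj N p)) p"
    by (rule gradsq_cong) (use bfun_eq t N in auto)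
  also have "\<dots> = (\<Sum>i\<in>UNIV. (Dd (DX i) (\<beta> N) q)\<^sup>2) + 2 * snd q / real N * (Dd DT (\<beta> N) q)\<^sup>2"
    unfolding q_def by (rule gradsq_proj) (intro smooth_diffable smooth_Dd \<beta>_smooth t)+
  also have "\<dots> = (\<beta> N q)\<^sup>2 * ((a N)\<^sup>2 * S q + 2 * snd q / real N * (1 / (2 * snd q) + a N * Dd DT f q)\<^sup>2)"
  proof -
    have "(\<Sum>i\<in>UNIV. (Dd (DX i) (\<beta> N) q)\<^sup>2) = (\<beta> N q)\<^sup>2 * ((a N)\<^sup>2 * S q)"
      using q by (simp add: Dd_\<beta> power_mult_distrib S_def sum_distrib_left)
    moreover have "(Dd DT (\<beta> N) q)\<^sup>2 = (\<beta> N q)\<^sup>2 * (1 / (2 * snd q) + a N * Dd DT f q)\<^sup>2"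
      using q by (simp add: Dd_\<beta> power_mult_distrib)
    ultimately show ?thesis by (simp only: distrib_left mult_ac)
  qed
  also have "\<dots> = (1 + a N * P N q) * (2 * real N * snd q * (a N)\<^sup>2 * S q
             + (1 + 2 * a N * snd q * Dd DT f q)\<^sup>2)"
  proof -
    have "2 * real N * snd q * ((a N)\<^sup>2 * S q + 2 * snd q / real N * (1 / (2 * snd q) + a N * Dd DT f q)\<^sup>2)
      = 2 * real N * snd q * (a N)\<^sup>2 * S q + (2 * snd q * (1 / (2 * snd q) + a N * Dd DT f q))\<^sup>2"
      using N by (simp add: power2_eq_square algebra_simps)
    also have "2 * snd q * (1 / (2 * snd q) + a N * Dd DT f q) = 1 + 2 * a N * snd q * Dd DT f q"
      using q by (simp add: field_simps)
    finally have eq: "2 * real N * snd q * ((a N)\<^sup>2 * S q + 2 * snd q / real N * (1 / (2 * snd q) + a N * Dd DT f q)\<^sup>2)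
      = 2 * real N * snd q * (a N)\<^sup>2 * S q + (1 + 2 * a N * snd q * Dd DT f q)\<^sup>2" .
    show ?thesis unfolding \<beta>_sq[OF N q(1)] eq[symmetric] by (simp only: mult_ac)
  qed
  finally show ?thesis by (simp add: d0_def G_def q_def)
qed

text \<open>N times the deviation of the quotient in \<open>lapm_d0_v\<close> from its limit. The
  first term stems from the correction R/N in G, the rest from the 1/N term of
  \<open>lapm_weighted\<close>.\<close>

definition Err :: "nat \<Rightarrow> (real^'n) \<times> real \<Rightarrow> real" where
  "Err N q = - Lop f (R N) q + (4 * Dd DT (\<lambda>q. G N q * u q) q
     + 2 * snd q * Dd DT (Dd DT (\<lambda>q. G N q * u q)) q) * inverse (u q)"

lemma ubdd_Err: "ubdd K Err"
  unfolding Err_def Lop_def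
  by (intro ubdd_intros ubdd_inverse_u usmooth_ubdd[OF usmooth_snd] usmooth_ubdd[OF usmooth_Dd]
      usmooth_intros f_usmooth usmooth_R usmooth_G usmooth_u)

lemma lapm_d0_v:
  assumes t: "tau N (snd p) > 0" and N: "N \<ge> 3"
  shows "lapm N (\<lambda>p. d0 f N p * vfun f N p) p / vfun f N p
      = - 4 * Lop f (D0 f) (proj N p) + Err N (proj N p) / real N"
proof -
  define q where "q = proj N p"
  have q: "q \<in> half" using proj_half[OF t] by (simp add: q_def)
  define e where "e = tpow ((2 - real N) / 2) q"
  have e: "e > 0" by (simp add: e_def tpow_def)
  have k: "vcoef N > 0" by (simp add: vcoef_def)
  have u: "u q > 0" by (rule u_pos[OF q])
  note sG = usmooth_family_smooth[OF usmooth_G N] and sR = usmooth_family_smooth[OF usmooth_R N]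
  let ?h = "\<lambda>q. G N q * u q"
  have sh: "smooth ?h" by (intro smooth_intros sG u_smooth)
  have "lapm N (\<lambda>p. d0 f N p * vfun f N p) p
      = lapm N (\<lambda>p. tpow ((2 - real N) / 2) (proj N p) * (vcoef N * (G N (proj N p) * u (proj N p)))) p"
    by (rule lapm_cong) (use d0_eq vfun_eq t N in auto)
  also have "\<dots> = e * ((\<Sum>i\<in>UNIV. Dd (DX i) (Dd (DX i) (\<lambda>q. vcoef N * ?h q)) q) - Dd DT (\<lambda>q. vcoef N * ?h q) q
           + (4 * Dd DT (\<lambda>q. vcoef N * ?h q) q + 2 * snd q * Dd DT (Dd DT (\<lambda>q. vcoef N * ?h q)) q) / real N)"
    unfolding e_def q_def
    by (rule lapm_weighted) (use t N in \<open>auto intro!: smooth_intros sG u_smooth\<close>)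
  also have "\<dots> = (vcoef N * e) * (- heatop ?h q + (4 * Dd DT ?h q + 2 * snd q * Dd DT (Dd DT ?h) q) / real N)"
    unfolding sDd_cmult[OF sh q] Dd2_cmult[OF sh q] heatop_def pdx_eq_Dd pdt_eq_Dd sum_distrib_left[symmetric]
    by (simp add: algebra_simps add_divide_distrib)
  also have "heatop ?h q = u q * Lop f (G N) q"
    by (rule heatop_mult_u[OF sG q])
  also have "Lop f (G N) q = Lop f (\<lambda>q. 4 * D0 f q + (1 / real N) * R N q) q"
    by (rule Lop_cong[OF _ q]) (simp add: G_expansion N)
  also have "\<dots> = 4 * Lop f (D0 f) q + (1 / real N) * Lop f (R N) q"
    using q by (simp only: Lop_add Lop_mult Lop_const smooth_intros D0_smooth sR Dd_const) simp
  finally have *: "lapm N (\<lambda>p. d0 f N p * vfun f N p) p = (vcoef N * e) *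
    (- (u q * (4 * Lop f (D0 f) q + (1 / real N) * Lop f (R N) q))
     + (4 * Dd DT ?h q + 2 * snd q * Dd DT (Dd DT ?h) q) / real N)" .
  have "\<dots> = vfun f N p * (- 4 * Lop f (D0 f) q + Err N q / real N)"
    unfolding vfun_eq[OF t N] q_def[symmetric] e_def[symmetric] Err_def
    using u N by (simp add: field_simps)
  moreover have "vfun f N p \<noteq> 0"
    unfolding vfun_eq[OF t N] q_def[symmetric] e_def[symmetric] using u e k by simp
  ultimately show ?thesis unfolding * q_def[symmetric] by simp
qed

end

context strip_solution
begin

subsection \<open>The trace-free Hessian of \<open>b\<^sup>2\<close>\<close>

definition \<kappa> :: "nat \<Rightarrow> real" where "\<kappa> N = 2 * (real N * a N)"

definition Q :: "nat \<Rightarrow> (real^'n) \<times> real \<Rightarrow> real" where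
  "Q N q = snd q * P N q"

text \<open>This is b^2, split so that the large part 2Nt is linear in t: second derivatives see
  only the bounded family Q.\<close>

definition H :: "nat \<Rightarrow> (real^'n) \<times> real \<Rightarrow> real" where
  "H N q = (2 * real N) * snd q + \<kappa> N * Q N q"

definition W :: "nat \<Rightarrow> (real^'n) \<times> real \<Rightarrow> real" where
  "W N q = (\<Sum>i\<in>UNIV. Dd (DX i) (Dd (DX i) (Q N)) q) + Dd DT (Q N) q
     + 2 * snd q * (1 / real N) * Dd DT (Dd DT (Q N)) q"

text \<open>\<open>N\<close> times the deviation of \<open>\<Delta>b\<^sup>2/m\<close> from its limit \<open>2\<close>.\<close>

definition \<Lambda> :: "nat \<Rightarrow> (real^'n) \<times> real \<Rightarrow> real" where
  "\<Lambda> N q = real N / mdim TYPE('n) N * (\<kappa> N * W N q - 2 * real CARD('n))"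

text \<open>The limit of the x-block of B, equal to 4t (Hess f - I/(2t)); \<open>U\<close> below is
  N times the deviation from it.\<close>

definition A :: "'n \<Rightarrow> 'n \<Rightarrow> (real^'n) \<times> real \<Rightarrow> real" where
  "A i j q = 4 * snd q * Dd (DX i) (Dd (DX j) f) q - (if i = j then 2 else 0)"

definition U :: "'n \<Rightarrow> 'n \<Rightarrow> nat \<Rightarrow> (real^'n) \<times> real \<Rightarrow> real" where
  "U i j N q = (real N * a N) * (- 4 * (real CARD('n) - 2) * snd q * Dd (DX i) (Dd (DX j) f) q
      + \<kappa> N * snd q * Dd (DX i) (Dd (DX j) (E N)) q) - (if i = j then 1 else 0) * \<Lambda> N q"

text \<open>N times the multiple of the identity in the y-block of B; \<open>V\<close> is N times
  the trace of its rank-one part.\<close>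

definition M :: "nat \<Rightarrow> (real^'n) \<times> real \<Rightarrow> real" where
  "M N q = \<kappa> N * Dd DT (Q N) q - \<Lambda> N q"

definition V :: "nat \<Rightarrow> (real^'n) \<times> real \<Rightarrow> real" where
  "V N q = 2 * snd q * (\<kappa> N * Dd DT (Dd DT (Q N)) q)"

text \<open>N times the difference between |B|^2 and the squared norm of the limit block A, with one
  line each for the x-block, the mixed blocks and the y-block.\<close>

definition BErr :: "nat \<Rightarrow> (real^'n) \<times> real \<Rightarrow> real" where
  "BErr N q = (\<Sum>i\<in>UNIV. \<Sum>j\<in>UNIV. 2 * A i j q * U i j N q + (1 / real N) * (U i j N q)\<^sup>2)
     + 2 * snd q * (\<kappa> N)\<^sup>2 * ((\<Sum>i\<in>UNIV. (Dd (DX i) (Dd DT (Q N)) q)\<^sup>2) + (\<Sum>i\<in>UNIV. (Dd DT (Dd (DX i) (Q N)) q)\<^sup>2))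
     + (M N q)\<^sup>2 + 2 * (1 / real N) * M N q * V N q + (1 / real N) * (V N q)\<^sup>2"

text \<open>N times the deviation of m/b^2 from 1/(2t). Writing N(e^(-2af) - 1) through a quotient
  by a makes its boundedness visible.\<close>

definition J :: "nat \<Rightarrow> (real^'n) \<times> real \<Rightarrow> real" where
  "J N q = 1 / 2 * inverse (snd q) * (real CARD('n) * exp (a N * (- 2 * f q))
      + (real N * a N) * ((exp (a N * (- 2 * f q)) - 1) / a N))"

definition Err' :: "nat \<Rightarrow> (real^'n) \<times> real \<Rightarrow> real" where
  "Err' N q = J N q * (\<Sum>i\<in>UNIV. \<Sum>j\<in>UNIV. (A i j q)\<^sup>2) + 1 / 2 * inverse (snd q) * BErr N q
     + (1 / real N) * J N q * BErr N q"

lemma usmooth_Q: "usmooth K Q"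
  unfolding Q_def by (intro usmooth_intros usmooth_P)

lemma ubdd_coeffs:
  shows "ubdd K (\<lambda>N q. \<kappa> N)" "ubdd K (\<lambda>N q. 1 / real N)" "ubdd K (\<lambda>N q. real N * a N)" "ubdd K (\<lambda>N q. a N)"
    "ubdd K (\<lambda>N q. real N / mdim TYPE('n) N)" "ubdd K (\<lambda>N. snd)" "ubdd K (\<lambda>N. f)"
proof -
  show Na: "ubdd K (\<lambda>N q. real N * a N)" and "ubdd K (\<lambda>N q. a N)" "ubdd K (\<lambda>N. snd)" "ubdd K (\<lambda>N. f)"
    by (intro usmooth_ubdd usmooth_Na usmooth_a usmooth_snd f_usmooth)+
  show "ubdd K (\<lambda>N q. \<kappa> N)" unfolding \<kappa>_def by (intro ubdd_intros Na)
  show "ubdd K (\<lambda>N q. 1 / real N)" by (rule ubdd_seq[of _ 1]) auto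
  show "ubdd K (\<lambda>N q. real N / mdim TYPE('n) N)"
    by (rule ubdd_seq[of _ 1]) (auto simp: mdim_def)
qed

lemma ubdd_Dd2: "usmooth K g \<Longrightarrow> ubdd K (\<lambda>N q. Dd c (Dd d (g N)) q)"
  by (intro usmooth_ubdd usmooth_Dd)

lemma ubdd_Lambda: "ubdd K \<Lambda>"
  unfolding \<Lambda>_def W_def
  by (intro ubdd_intros ubdd_coeffs ubdd_Dd2 usmooth_Q usmooth_ubdd[OF usmooth_Dd])

lemma ubdd_A: "ubdd K (\<lambda>N. A i j)"
  unfolding A_def by (intro ubdd_intros ubdd_coeffs ubdd_Dd2 f_usmooth)

lemma ubdd_U: "ubdd K (U i j)"
  unfolding U_def by (intro ubdd_intros ubdd_coeffs ubdd_Dd2 f_usmooth usmooth_E ubdd_Lambda)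

lemma ubdd_BErr: "ubdd K BErr"
  unfolding BErr_def M_def V_def
  by (intro ubdd_intros ubdd_coeffs ubdd_Dd2 usmooth_Q usmooth_ubdd[OF usmooth_Dd] ubdd_Lambda ubdd_A ubdd_U)

lemma ubdd_J: "ubdd K J"
  unfolding J_def
  by (intro ubdd_intros ubdd_coeffs ubdd_inverse_snd ubdd_exp_quotients(1)) (use a_pos a_le in auto)

lemma ubdd_Err': "ubdd K Err'"
  unfolding Err'_def by (intro ubdd_intros ubdd_coeffs ubdd_inverse_snd ubdd_A ubdd_BErr ubdd_J)

lemma H_eq: "N \<ge> 3 \<Longrightarrow> H N q = 2 * real N * snd q * (1 + a N * P N q)"
  by (simp add: H_def Q_def \<kappa>_def algebra_simps)

context
  fixes N :: nat
  assumes N: "N \<ge> 3"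
begin

lemma Q_smooth: "smooth (Q N)" and E_smooth: "smooth (E N)"
  using usmooth_family_smooth[OF _ N] usmooth_Q usmooth_E by auto

lemma H_smooth: "smooth (H N)"
  unfolding H_def by (intro smooth_intros Q_smooth)

lemma Dd_H: "q \<in> half \<Longrightarrow> Dd d (H N) q = (if d = DT then 2 * real N else 0) + \<kappa> N * Dd d (Q N) q"
  unfolding H_def by (simp only: sDd_add sDd_cmult smooth_intros Q_smooth Dd_snd) simp

lemma Dd2_H:
  assumes q: "q \<in> half"
  shows "Dd c (Dd d (H N)) q = \<kappa> N * Dd c (Dd d (Q N)) q"
proof -
  have "Dd c (Dd d (H N)) q = Dd c (\<lambda>q. (if d = DT then 2 * real N else 0) + \<kappa> N * Dd d (Q N) q) q"
    by (rule Dd_cong[OF _ q]) (simp add: Dd_H)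
  also have "\<dots> = \<kappa> N * Dd c (Dd d (Q N)) q"
    using q by (simp only: sDd_add sDd_cmult smooth_intros Q_smooth Dd_const)
  finally show ?thesis .
qed

text \<open>The x-block of B is of order one, so to isolate its limit with an error O(1/N) the
  expansion P = 2f + aE is inserted.\<close>

lemma Dx2_Q:
  assumes q: "q \<in> half"
  shows "Dd (DX i) (Dd (DX j) (Q N)) q
     = snd q * (2 * Dd (DX i) (Dd (DX j) f) q + a N * Dd (DX i) (Dd (DX j) (E N)) q)"
proof -
  have Q: "Q N = (\<lambda>q. snd q * (2 * f q + a N * E N q))"
    by (auto simp: Q_def P_eq_E[OF N])
  have "Dd (DX i) (Dd (DX j) (Q N)) q = Dd (DX i) (\<lambda>q. snd q * (2 * Dd (DX j) f q + a N * Dd (DX j) (E N) q)) q"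
    unfolding Q
    by (rule Dd_cong[OF _ q])
      (simp only: sDd_mult[of snd] sDd_add sDd_cmult smooth_intros f_smooth E_smooth Dd_snd, simp)
  also have "\<dots> = snd q * (2 * Dd (DX i) (Dd (DX j) f) q + a N * Dd (DX i) (Dd (DX j) (E N)) q)"
    using q by (simp only: sDd_mult[of snd] sDd_add sDd_cmult smooth_intros f_smooth E_smooth Dd_snd) simp
  finally show ?thesis .
qed

lemma Bsq_eq:
  assumes t: "tau N (snd p) > 0"
  shows "Bsq f N p = (\<Sum>i\<in>UNIV. \<Sum>j\<in>UNIV. (A i j (proj N p))\<^sup>2) + BErr N (proj N p) / real N"
proof -
  define q where "q = proj N p"
  define l0 where "l0 = lapm N (\<lambda>q. (bfun f N q)\<^sup>2) p / mdim TYPE('n) N"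
  have q: "q \<in> half" using proj_half[OF t] by (simp add: q_def)
  have N0: "real N > 0" using N by simp
  have m0: "mdim TYPE('n) N > 0" by (rule mdim_bounds[OF N])
  have b: "(bfun f N p')\<^sup>2 = H N (proj N p')" if "tau N (snd p') > 0" for p'
    using that N by (simp add: bfun_eq \<beta>_sq proj_half H_eq)
  have "lapm N (\<lambda>q. (bfun f N q)\<^sup>2) p = lapm N (\<lambda>p. H N (proj N p)) p"
    by (rule lapm_cong[OF b t])
  also have "\<dots> = (\<Sum>i\<in>UNIV. Dd (DX i) (Dd (DX i) (H N)) q) + Dd DT (H N) q
       + 2 * snd q / real N * Dd DT (Dd DT (H N)) q"
    unfolding q_def by (rule lapm_proj) (intro smooth_diffable smooth_Dd H_smooth t)+
  also have "\<dots> = 2 * real N + \<kappa> N * W N q"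
    using q by (simp add: Dd_H Dd2_H W_def sum_distrib_left algebra_simps)
  \<comment> \<open>With m = N + n, the deviation of (2N + \<kappa> W)/m from 2 is (\<kappa> W -
    2n)/m.\<close>
  finally have l0: "l0 = 2 + \<Lambda> N q / real N"
    using N0 m0 by (simp add: l0_def \<Lambda>_def field_simps) (simp add: mdim_def algebra_simps)
  have pd: "pd k (pd l (\<lambda>q. (bfun f N q)\<^sup>2)) p = pd k (pd l (\<lambda>p. H N (proj N p))) p"
    if "k \<in> idx N" "l \<in> idx N" for k l
    by (rule pd_cong[OF pd_cong[OF b] t]) (use that in auto)
  have xx: "(\<Sum>i\<in>UNIV. \<Sum>j\<in>UNIV. (Dd (DX i) (Dd (DX j) (H N)) q - (if i = j then l0 else 0))\<^sup>2)
      = (\<Sum>i\<in>UNIV. \<Sum>j\<in>UNIV. (A i j q)\<^sup>2)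
       + (\<Sum>i\<in>UNIV. \<Sum>j\<in>UNIV. 2 * A i j q * U i j N q + (1 / real N) * (U i j N q)\<^sup>2) / real N"
    unfolding sum_divide_distrib sum.distrib[symmetric]
  proof (intro sum.cong refl)
    fix i j
    define F e where "F = Dd (DX i) (Dd (DX j) f) q" "e = Dd (DX i) (Dd (DX j) (E N)) q"
    have k: "\<kappa> N = 2 * (1 - (real CARD('n) - 2) * a N)" unfolding \<kappa>_def Na[OF N] ..
    have "\<kappa> N * (snd q * (2 * F + a N * e)) = \<kappa> N * (2 * snd q * F) + a N * (\<kappa> N * snd q * e)"
      by (simp add: algebra_simps)
    also have "\<kappa> N * (2 * snd q * F) = 4 * snd q * F + a N * (- 4 * (real CARD('n) - 2) * snd q * F)"
      unfolding k by (simp add: algebra_simps)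
    finally have "Dd (DX i) (Dd (DX j) (H N)) q
        = 4 * snd q * F + a N * (- 4 * (real CARD('n) - 2) * snd q * F + \<kappa> N * snd q * e)"
      using q by (simp add: Dd2_H Dx2_Q F_e_def algebra_simps)
    moreover have "U i j N q / real N = a N * (- 4 * (real CARD('n) - 2) * snd q * F + \<kappa> N * snd q * e)
        - (if i = j then \<Lambda> N q / real N else 0)"
      using N0 by (simp add: U_def F_e_def diff_divide_distrib)
    ultimately have "Dd (DX i) (Dd (DX j) (H N)) q - (if i = j then l0 else 0) = A i j q + U i j N q / real N"
      by (simp add: A_def l0 F_e_def)
    then show "(Dd (DX i) (Dd (DX j) (H N)) q - (if i = j then l0 else 0))\<^sup>2
        = (A i j q)\<^sup>2 + (2 * A i j q * U i j N q + (1 / real N) * (U i j N q)\<^sup>2) / real N"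
      using N0 by (simp only:) (simp add: power2_eq_square field_simps)
  qed
  have \<mu>: "Dd DT (H N) q / real N - l0 = M N q / real N"
    using N0 q by (simp add: Dd_H M_def l0 field_simps)
  have V: "2 * snd q / real N * Dd DT (Dd DT (H N)) q = V N q / real N"
    using q by (simp add: Dd2_H V_def)
  have mixed: "2 * snd q / real N * ((\<kappa> N)\<^sup>2 * x + (\<kappa> N)\<^sup>2 * y) = 2 * snd q * (\<kappa> N)\<^sup>2 * (x + y) / real N" for x y
    by (simp add: algebra_simps add_divide_distrib)
  \<comment> \<open>The first summand is the diagonal of the y-block: N entries of size 1/N, whose
    squares add up to order 1/N.\<close>
  have vertical: "real N * (x / real N)\<^sup>2 + 2 * (x / real N) * (y / real N) + (y / real N)\<^sup>2
      = x\<^sup>2 / real N + 2 * (1 / real N) * x * y / real N + (1 / real N) * y\<^sup>2 / real N" for x y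
    using N0 by (simp add: field_simps power2_eq_square)
  have "Bsq f N p = (\<Sum>k\<in>idx N. \<Sum>l\<in>idx N. (pd k (pd l (\<lambda>p. H N (proj N p))) p - (if k = l then l0 else 0))\<^sup>2)"
    unfolding Bsq_def l0_def[symmetric] by (intro sum.cong refl) (simp only: pd)
  also have "\<dots> = (\<Sum>i\<in>UNIV. \<Sum>j\<in>UNIV. (Dd (DX i) (Dd (DX j) (H N)) q - (if i = j then l0 else 0))\<^sup>2)
     + 2 * snd q / real N * ((\<Sum>i\<in>UNIV. (Dd (DX i) (Dd DT (H N)) q)\<^sup>2)
                                  + (\<Sum>i\<in>UNIV. (Dd DT (Dd (DX i) (H N)) q)\<^sup>2))
     + (real N * (Dd DT (H N) q / real N - l0)\<^sup>2
        + 2 * (Dd DT (H N) q / real N - l0) * (2 * snd q / real N * Dd DT (Dd DT (H N)) q)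
        + (2 * snd q / real N * Dd DT (Dd DT (H N)) q)\<^sup>2)"
    unfolding q_def by (rule sum_sq_shifted_hessian_proj) (intro smooth_diffable smooth_Dd H_smooth t)+
  also have "(\<Sum>i\<in>UNIV. (Dd (DX i) (Dd DT (H N)) q)\<^sup>2) = (\<kappa> N)\<^sup>2 * (\<Sum>i\<in>UNIV. (Dd (DX i) (Dd DT (Q N)) q)\<^sup>2)"
    using q by (simp add: Dd2_H power_mult_distrib sum_distrib_left)
  also have "(\<Sum>i\<in>UNIV. (Dd DT (Dd (DX i) (H N)) q)\<^sup>2) = (\<kappa> N)\<^sup>2 * (\<Sum>i\<in>UNIV. (Dd DT (Dd (DX i) (Q N)) q)\<^sup>2)"
    using q by (simp add: Dd2_H power_mult_distrib sum_distrib_left)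
  finally show ?thesis
    unfolding xx \<mu> V mixed vertical BErr_def q_def[symmetric] add_divide_distrib by (simp only: add.assoc)
qed

lemma mdim_over_b_sq:
  assumes t: "tau N (snd p) > 0"
  shows "mdim TYPE('n) N / (bfun f N p)\<^sup>2 = 1 / 2 * inverse (snd (proj N p)) + J N (proj N p) / real N"
proof -
  define q where "q = proj N p"
  define e where "e = exp (a N * (- 2 * f q))"
  have q: "q \<in> half" "snd q > 0" using proj_half[OF t] by (auto simp: q_def half_iff)
  have N0: "real N > 0" using N by simp
  have "1 + a N * P N q = exp (- (a N * (- 2 * f q)))"
    by (simp add: exp_eq_P[OF N, symmetric])
  also have "\<dots> = inverse e" by (simp only: exp_minus e_def)
  finally have b: "(bfun f N p)\<^sup>2 = 2 * real N * snd q * inverse e"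
    using t N q by (simp add: bfun_eq \<beta>_sq q_def)
  have "e > 0" by (simp add: e_def)
  moreover have "J N q = 1 / 2 * inverse (snd q) * (real CARD('n) * e + real N * (e - 1))"
    using a_pos[OF N] by (simp add: J_def e_def)
  ultimately show ?thesis
    unfolding b q_def[symmetric] using q N0 by (simp add: mdim_def field_simps)
qed

text \<open>The leading term |A|^2/(2t) equals 8t |Hess f - I/(2t)|^2, which \<open>Lop_D0\<close>
  identifies.\<close>

lemma mdim_over_b_sq_Bsq:
  assumes t: "tau N (snd p) > 0"
  shows "mdim TYPE('n) N / (bfun f N p)\<^sup>2 * Bsq f N p = - 4 * Lop f (D0 f) (proj N p) + Err' N (proj N p) / real N"
proof -
  define q where "q = proj N p"
  have q: "q \<in> half" "snd q > 0" using proj_half[OF t] by (auto simp: q_def half_iff)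
  have N0: "real N > 0" using N by simp
  have "(\<Sum>i\<in>UNIV. \<Sum>j\<in>UNIV. (A i j q)\<^sup>2) = (4 * snd q)\<^sup>2 * (\<Sum>i\<in>UNIV. \<Sum>j\<in>UNIV.
           (Dd (DX i) (Dd (DX j) f) q - (if i = j then 1 / (2 * snd q) else 0))\<^sup>2)"
    unfolding sum_distrib_left power_mult_distrib[symmetric]
    by (intro sum.cong refl arg_cong[where f = "\<lambda>z. z\<^sup>2"]) (use q in \<open>auto simp: A_def algebra_simps\<close>)
  then have "- 4 * Lop f (D0 f) q = 1 / 2 * inverse (snd q) * (\<Sum>i\<in>UNIV. \<Sum>j\<in>UNIV. (A i j q)\<^sup>2)"
    using q by (simp add: Lop_D0 field_simps power2_eq_square)
  then show ?thesis
    unfolding mdim_over_b_sq[OF t] Bsq_eq[OF t] q_def[symmetric] Err'_def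
    using N0 by (simp add: field_simps)
qed

end

end

section \<open>Uniform constants for the three estimates\<close>

theorem theorem1p1:
  fixes u f :: "(real^'n::finite) \<times> real \<Rightarrow> real" and \<tau>1 \<tau>2 :: real
  assumes "0 < \<tau>1" and "\<tau>1 < \<tau>2"
    and "\<forall>x t. t > 0 \<longrightarrow> u (x, t) > 0"
    and "smooth_half u"
    and "\<forall>x t. t > 0 \<longrightarrow> pdt u (x, t) = (\<Sum>i\<in>UNIV. pdx i (pdx i u) (x, t))"
    and "\<forall>x t. t > 0 \<longrightarrow> u (x, t) = t powr (- real CARD('n) / 2) * exp (- f (x, t))"
    and "\<forall>ds. bounded (Dit ds f ` (UNIV \<times> {\<tau>1..\<tau>2}))"
  shows "\<exists>C. \<forall>N::nat. N \<ge> 3 \<longrightarrow> (\<forall>x y. 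
           \<tau>1 \<le> (normy N y)^2 / (2 * real N) \<and> (normy N y)^2 / (2 * real N) \<le> \<tau>2 \<longrightarrow>
           \<bar>lapm N (\<lambda>p. d0 f N p * vfun f N p) (x, y) / vfun f N (x, y)
              - mdim TYPE('n) N / (bfun f N (x, y))^2 * Bsq f N (x, y)\<bar> \<le> C / real N
         \<and> \<bar>d0 f N (x, y) - 4 * D0 f (x, (normy N y)^2 / (2 * real N))\<bar> \<le> C / real N
         \<and> \<bar>lapm N (\<lambda>p. d0 f N p * vfun f N p) (x, y) / vfun f N (x, y)
              + 4 * heatop (\<lambda>q. D0 f q * u q) (x, (normy N y)^2 / (2 * real N))
                  / u (x, (normy N y)^2 / (2 * real N))\<bar> \<le> C / real N)"
proof -
  define K where "K = (UNIV :: (real^'n) set) \<times> {\<tau>1..\<tau>2}"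
  interpret heat_solution u f
    by unfold_locales (use assms in \<open>auto simp: half_iff smooth_half_iff pdx_eq_Dd pdt_eq_Dd\<close>)
  interpret strip_solution u f K "acoef TYPE('n)"
  proof unfold_locales
    show "\<exists>a b. a > 0 \<and> (\<forall>p\<in>K. a \<le> snd p \<and> snd p \<le> b)"
      using assms(1) by (intro exI[of _ \<tau>1] exI[of _ \<tau>2]) (auto simp: K_def)
    show "usmooth K (\<lambda>N. f)"
      by (rule usmooth_of_bounded_Dit[OF f_smooth]) (use assms(7) in \<open>simp add: K_def\<close>)
  qed simp
  \<comment> \<open>Both quantities in the first estimate have the leading term -4
    \<open>Lop f (D0 f)\<close>, which cancels exactly; only the two errors remain to be
    bounded.\<close>
  obtain C1 where C1: "C1 \<ge> 0" "\<And>N p. N \<ge> 3 \<Longrightarrow> p \<in> K \<Longrightarrow> \<bar>Err N p - Err' N p\<bar> \<le> C1"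
    using ubddE[OF ubdd_diff[OF ubdd_Err ubdd_Err']] by metis
  obtain C2 where C2: "C2 \<ge> 0" "\<And>N p. N \<ge> 3 \<Longrightarrow> p \<in> K \<Longrightarrow> \<bar>R N p\<bar> \<le> C2"
    using ubddE[OF usmooth_ubdd[OF usmooth_R]] by metis
  obtain C3 where C3: "C3 \<ge> 0" "\<And>N p. N \<ge> 3 \<Longrightarrow> p \<in> K \<Longrightarrow> \<bar>Err N p\<bar> \<le> C3"
    using ubddE[OF ubdd_Err] by metis
  \<comment> \<open>The sum dominates each constant because all three are nonnegative.\<close>
  define C where "C = C1 + C2 + C3"
  have quot: "\<bar>z / real N\<bar> \<le> C / real N" if "\<bar>z\<bar> \<le> C" for z N
    using that by (simp add: divide_right_mono)
  show ?thesis
  proof (intro exI[of _ C] allI impI)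
    fix N :: nat and x :: "real^'n" and y
    assume N: "N \<ge> 3" and "\<tau>1 \<le> (normy N y)^2 / (2 * real N) \<and> (normy N y)^2 / (2 * real N) \<le> \<tau>2"
    then have tau: "\<tau>1 \<le> tau N y" "tau N y \<le> \<tau>2" by (auto simp: tau_def)
    define q where "q = proj N (x, y)"
    have q: "q = (x, tau N y)" by (simp add: q_def proj_def)
    have qK: "q \<in> K" using tau by (simp add: K_def q)
    have t: "tau N (snd (x, y)) > 0" using tau assms(1) by simp
    have qh: "q \<in> half" by (rule K_half[OF qK])
    note lap = lapm_d0_v[OF t N, folded q_def]
    have heat: "heatop (\<lambda>q. D0 f q * u q) q / u q = Lop f (D0 f) q"
      using heatop_mult_u[OF D0_smooth qh] u_pos[OF qh] by simp
    have 1: "lapm N (\<lambda>p. d0 f N p * vfun f N p) (x, y) / vfun f N (x, y)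
              - mdim TYPE('n) N / (bfun f N (x, y))^2 * Bsq f N (x, y) = (Err N q - Err' N q) / real N"
      unfolding lap mdim_over_b_sq_Bsq[OF N t, folded q_def] by (simp add: diff_divide_distrib)
    have 2: "d0 f N (x, y) - 4 * D0 f q = R N q / real N"
      unfolding d0_eq[OF t N, folded q_def] G_expansion[OF N qh] by simp
    have 3: "lapm N (\<lambda>p. d0 f N p * vfun f N p) (x, y) / vfun f N (x, y)
              + 4 * heatop (\<lambda>q. D0 f q * u q) q / u q = Err N q / real N"
      unfolding lap using heat by (simp add: times_divide_eq_right[symmetric] del: times_divide_eq_right)
    show "\<bar>lapm N (\<lambda>p. d0 f N p * vfun f N p) (x, y) / vfun f N (x, y)
              - mdim TYPE('n) N / (bfun f N (x, y))^2 * Bsq f N (x, y)\<bar> \<le> C / real N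
         \<and> \<bar>d0 f N (x, y) - 4 * D0 f (x, (normy N y)^2 / (2 * real N))\<bar> \<le> C / real N
         \<and> \<bar>lapm N (\<lambda>p. d0 f N p * vfun f N p) (x, y) / vfun f N (x, y)
              + 4 * heatop (\<lambda>q. D0 f q * u q) (x, (normy N y)^2 / (2 * real N))
                  / u (x, (normy N y)^2 / (2 * real N))\<bar> \<le> C / real N"
      unfolding tau_def[symmetric] q[symmetric] 1 2 3
      by (intro conjI quot)
         (use C1(1) C2(1) C3(1) C1(2)[OF N qK] C2(2)[OF N qK] C3(2)[OF N qK] in \<open>auto simp: C_def\<close>)
  qed
qed

end
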